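(* Let $M$ be a compact and connected manifold. The enlarged pseudograph $\mathcal{E}(u)$ of any semi-concave function $u:M\to\mathbb{R}$ is a Lipschitz exact Lagrangian submanifold of $T^*M$.
   Context: Manifolds are smooth and without boundary; $d=\dim M$. Semi-concave functions: if $U\subset\mathbb{R}^d$ is open and $K\ge 0$, a function $w:U\to\mathbb{R}$ is $K$-semi-concave if for every $x\in U$ there is a linear form $p_x$ on $\mathbb{R}^d$ such that $w(y)\le w(x)+p_x(y-x)+K\|y-x\|^2$ for all $y\in U$ ($\|\cdot\|$ the Euclidean norm); such a $p_x$ is called a $K$-super-differential of $w$ at $x$. Fix a finite atlas $\mathcal{A}=\{(U_i,\Phi_i:U_i\to\mathbb{R}^d);1\le i\le N\}$ of $M$. A function $u:M\to\mathbb{R}$ is $K$-semi-concave if $u\circ\Phi_i^{-1}:\Phi_i(U_i)\to\mathbb{R}$ is $K$-semi-concave for every $i$; a ($K$-)super-differential of $u$ at $x\in U_i$ is a linear form $p\circ D\Phi_i(x)\in T_x^*M$ where $p$ is a $K$-super-differential of $u\circ\Phi_i^{-1}$ at $\Phi_i(x)$. The function $u$ is semi-concave if it is $K$-semi-concave for some $K$. Enlarged pseudograph: for $u$ semi-concave, with a constant $K$ fixed for which $u$ is $K$-semi-concave, $\mathcal{E}(u)=\{(x,p_x)\in T^*M;\ p_x \text{ is a } (K\text{-})\text{super-differential of } u \text{ at } x\}$. Lipschitz submanifold: a non-empty subset $N\subset T^*M$ is a ($d$-dimensional) Lipschitz submanifold of $T^*M$ if for every $x\in N$ there is a smooth chart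 $(U,\Phi)$ of $T^*M$ at $x$ such that $\Phi(N\cap U)$ is the graph of a Lipschitz map $\ell:V\to\mathbb{R}^d$ defined on an open subset $V$ of $\mathbb{R}^d$. Exact Lagrangian: a $d$-dimensional Lipschitz submanifold $N$ of $T^*M$ is exact Lagrangian if for every closed Lipschitz arc $\gamma:[a,b]\to N$ (i.e. $\gamma(a)=\gamma(b)$) one has $\int_\gamma\lambda=0$, where $\lambda$ is the Liouville $1$-form of $T^*M$. *)

theory Defs
  imports "HOL-Analysis.Analysis"
begin

section \<open>Smooth maps between Euclidean spaces\<close>

text \<open>The domain \<open>S\<close> is always meant to be open.\<close>

primrec Ck_on :: "nat \<Rightarrow> 'a::real_normed_vector set \<Rightarrow> ('a \<Rightarrow> 'b::real_normed_vector) \<Rightarrow> bool" where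
  "Ck_on 0 S f \<longleftrightarrow> continuous_on S f"
| "Ck_on (Suc k) S f \<longleftrightarrow> (\<forall>x\<in>S. f differentiable (at x)) \<and>
     (\<forall>v. Ck_on k S (\<lambda>x. frechet_derivative f (at x) v))"

definition smooth_on :: "'a::real_normed_vector set \<Rightarrow> ('a \<Rightarrow> 'b::real_normed_vector) \<Rightarrow> bool" where
  "smooth_on S f \<longleftrightarrow> (\<forall>k. Ck_on k S f)"


section \<open>Charts and atlases\<close>

text \<open>A chart is a pair of its domain and its coordinate map; the values of the coordinate map
  outside of the domain are irrelevant.\<close>

type_synonym ('a, 'e) chart = "'a set \<times> ('a \<Rightarrow> 'e)"

definition chart_inv :: "('a, 'e) chart \<Rightarrow> 'e \<Rightarrow> 'a" where
  "chart_inv c = inv_into (fst c) (snd c)"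

definition transition :: "('a, 'e) chart \<Rightarrow> ('a, 'e) chart \<Rightarrow> 'e \<Rightarrow> 'e" where
  "transition c c' = snd c' \<circ> chart_inv c"

definition smooth_compatible ::
    "('a, 'e::euclidean_space) chart \<Rightarrow> ('a, 'e) chart \<Rightarrow> bool" where
  "smooth_compatible c c' \<longleftrightarrow>
     open (snd c ` (fst c \<inter> fst c')) \<and> open (snd c' ` (fst c \<inter> fst c')) \<and>
     smooth_on (snd c ` (fst c \<inter> fst c')) (transition c c') \<and>
     smooth_on (snd c' ` (fst c \<inter> fst c')) (transition c' c)"

text \<open>A smooth manifold (Hausdorff, second countable, without boundary, of dimension
  \<open>DIM('e)\<close>) whose smooth structure is the one generated by the atlas \<open>A\<close>.\<close>

definition smooth_manifold :: "'a topology \<Rightarrow> ('a, 'e::euclidean_space) chart set \<Rightarrow> bool" where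
  "smooth_manifold X A \<longleftrightarrow>
     Hausdorff_space X \<and> second_countable X \<and>
     (\<Union>c\<in>A. fst c) = topspace X \<and>
     (\<forall>c\<in>A. openin X (fst c) \<and> open (snd c ` fst c) \<and>
        homeomorphic_map (subtopology X (fst c)) (top_of_set (snd c ` fst c)) (snd c)) \<and>
     (\<forall>c\<in>A. \<forall>c'\<in>A. smooth_compatible c c')"

text \<open>The maximal atlas generated by an atlas \<open>A\<close>. No topology has to be supplied: the topology
  induced by \<open>A\<close> is determined by \<open>A\<close>, and compatibility with all of \<open>A\<close> makes the
  domain open and the coordinate map a homeomorphism for it.\<close>

definition smooth_charts :: "('a, 'e::euclidean_space) chart set \<Rightarrow> ('a, 'e) chart set" where
  "smooth_charts A = {c. fst c \<subseteq> (\<Union>c'\<in>A. fst c') \<and> inj_on (snd c) (fst c) \<and>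
     open (snd c ` fst c) \<and> (\<forall>c'\<in>A. smooth_compatible c c')}"

definition charts_at :: "('a, 'e) chart set \<Rightarrow> 'a \<Rightarrow> ('a, 'e) chart set" where
  "charts_at A x = {c \<in> A. x \<in> fst c}"


section \<open>Tangent and cotangent vectors\<close>

text \<open>A tangent vector at \<open>x\<close> is the family of its coordinate vectors in the charts of \<open>A\<close> around
  \<open>x\<close>, related by the derivatives of the transition maps (and \<open>0\<close> for all other charts).
  Hence the derivative at \<open>x\<close> of the coordinate map of a chart \<open>c\<close> is the evaluation
  \<open>v \<mapsto> v c\<close>.\<close>

type_synonym ('a, 'e) tangent = "('a, 'e) chart \<Rightarrow> 'e"

definition tangent_space ::
    "('a, 'e::euclidean_space) chart set \<Rightarrow> 'a \<Rightarrow> ('a, 'e) tangent set" where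
  "tangent_space A x = {v.
     (\<forall>c. c \<notin> charts_at A x \<longrightarrow> v c = 0) \<and>
     (\<forall>c\<in>charts_at A x. \<forall>c'\<in>charts_at A x.
        v c' = frechet_derivative (transition c c') (at (snd c x)) (v c))}"

text \<open>Linear forms on the tangent space; being functions on a larger type they are fixed to
  \<open>undefined\<close> outside of the tangent space.\<close>

definition cotangent_space ::
    "('a, 'e::euclidean_space) chart set \<Rightarrow> 'a \<Rightarrow> (('a, 'e) tangent \<Rightarrow> real) set" where
  "cotangent_space A x = {p \<in> extensional (tangent_space A x).
     (\<forall>v\<in>tangent_space A x. \<forall>w\<in>tangent_space A x. p (\<lambda>c. v c + w c) = p v + p w) \<and>
     (\<forall>r. \<forall>v\<in>tangent_space A x. p (\<lambda>c. r *\<^sub>R v c) = r * p v)}"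

type_synonym ('a, 'e) covector = "'a \<times> (('a, 'e) tangent \<Rightarrow> real)"

definition cotangent_bundle ::
    "('a, 'e::euclidean_space) chart set \<Rightarrow> ('a, 'e) covector set" where
  "cotangent_bundle A = {(x, p). x \<in> (\<Union>c\<in>A. fst c) \<and> p \<in> cotangent_space A x}"

text \<open>The canonical coordinates \<open>(x, q)\<close> on the cotangent bundle associated with a chart \<open>c\<close>:
  \<open>q\<close> is the vector of coefficients of the covector with respect to the differentials of the
  coordinate functions of \<open>c\<close>.\<close>

definition cotangent_chart ::
    "('a, 'e::euclidean_space) chart set \<Rightarrow> ('a, 'e) chart \<Rightarrow> (('a, 'e) covector, 'e \<times> 'e) chart" where
  "cotangent_chart A c =
     ({z \<in> cotangent_bundle A. fst z \<in> fst c},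
      \<lambda>(x, p). (snd c x, THE q. \<forall>v\<in>tangent_space A x. p v = q \<bullet> v c))"

definition cotangent_atlas ::
    "('a, 'e::euclidean_space) chart set \<Rightarrow> (('a, 'e) covector, 'e \<times> 'e) chart set" where
  "cotangent_atlas A = cotangent_chart A ` A"

text \<open>The derivative at \<open>x\<close> of a map \<open>f\<close> between manifolds with atlases \<open>A\<close> and \<open>B\<close>, computed in
  an arbitrary chart of \<open>A\<close> around \<open>x\<close>; on tangent vectors the choice does not matter.\<close>

definition differential ::
    "('a, 'e::euclidean_space) chart set \<Rightarrow> ('b, 'f::euclidean_space) chart set \<Rightarrow>
     ('a \<Rightarrow> 'b) \<Rightarrow> 'a \<Rightarrow> ('a, 'e) tangent \<Rightarrow> ('b, 'f) tangent" where
  "differential A B f x v =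
     (let c = (SOME c. c \<in> charts_at A x) in
      (\<lambda>c'. if c' \<in> charts_at B (f x)
            then frechet_derivative (snd c' \<circ> f \<circ> chart_inv c) (at (snd c x)) (v c) else 0))"

text \<open>The Liouville form: \<open>\<lambda>\<^bsub>(x,p)\<^esub>(\<xi>) = p (D\<pi> \<xi>)\<close> for \<open>\<xi>\<close> tangent to the cotangent bundle
  at \<open>(x, p)\<close>, where \<open>\<pi>\<close> is the bundle projection.\<close>

definition liouville_form ::
    "('a, 'e::euclidean_space) chart set \<Rightarrow>
     ('a, 'e) covector \<Rightarrow> (('a, 'e) covector, 'e \<times> 'e) tangent \<Rightarrow> real" where
  "liouville_form A z \<xi> = snd z (differential (cotangent_atlas A) A fst z \<xi>)"


section \<open>Integration of 1-forms along Lipschitz arcs\<close>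

text \<open>Lipschitz in local charts, which on a compact interval amounts to being Lipschitz for the
  distance of any Riemannian metric.\<close>

definition lipschitz_arc ::
    "('a, 'e::euclidean_space) chart set \<Rightarrow> real \<Rightarrow> real \<Rightarrow> (real \<Rightarrow> 'a) \<Rightarrow> bool" where
  "lipschitz_arc A a b \<gamma> \<longleftrightarrow> a \<le> b \<and>
     (\<forall>t\<in>{a..b}. \<exists>c\<in>smooth_charts A. \<exists>\<delta>>0. \<exists>L.
        \<gamma> ` ({a..b} \<inter> ball t \<delta>) \<subseteq> fst c \<and> L-lipschitz_on ({a..b} \<inter> ball t \<delta>) (snd c \<circ> \<gamma>))"

text \<open>Meaningful at the times where \<open>\<gamma>\<close> is differentiable, hence at almost every time for a
  Lipschitz arc.\<close>

definition velocity ::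
    "('a, 'e::euclidean_space) chart set \<Rightarrow> real \<Rightarrow> real \<Rightarrow> (real \<Rightarrow> 'a) \<Rightarrow> real \<Rightarrow> ('a, 'e) tangent" where
  "velocity A a b \<gamma> t =
     (\<lambda>c. if c \<in> charts_at A (\<gamma> t) then vector_derivative (snd c \<circ> \<gamma>) (at t within {a..b}) else 0)"

definition has_arc_integral ::
    "('a, 'e::euclidean_space) chart set \<Rightarrow> ('a \<Rightarrow> ('a, 'e) tangent \<Rightarrow> real) \<Rightarrow>
     real \<Rightarrow> real \<Rightarrow> (real \<Rightarrow> 'a) \<Rightarrow> real \<Rightarrow> bool" where
  "has_arc_integral A \<omega> a b \<gamma> I \<longleftrightarrow>
     ((\<lambda>t. \<omega> (\<gamma> t) (velocity A a b \<gamma> t)) has_integral I) {a..b}"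


section \<open>Lipschitz exact Lagrangian submanifolds of the cotangent bundle\<close>

definition lipschitz_submanifold ::
    "('a, 'e::euclidean_space) chart set \<Rightarrow> ('a, 'e) covector set \<Rightarrow> bool" where
  "lipschitz_submanifold A N \<longleftrightarrow> N \<noteq> {} \<and> N \<subseteq> cotangent_bundle A \<and>
     (\<forall>z\<in>N. \<exists>(U, \<Phi>)\<in>smooth_charts (cotangent_atlas A). z \<in> U \<and>
        (\<exists>(V :: 'e set) (l :: 'e \<Rightarrow> 'e) L. open V \<and> L-lipschitz_on V l \<and>
           \<Phi> ` (N \<inter> U) = (\<lambda>y. (y, l y)) ` V))"

definition exact_lagrangian ::
    "('a, 'e::euclidean_space) chart set \<Rightarrow> ('a, 'e) covector set \<Rightarrow> bool" where
  "exact_lagrangian A N \<longleftrightarrow> lipschitz_submanifold A N \<and>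
     (\<forall>a b \<gamma>. lipschitz_arc (cotangent_atlas A) a b \<gamma> \<and> \<gamma> ` {a..b} \<subseteq> N \<and> \<gamma> a = \<gamma> b \<longrightarrow>
        has_arc_integral (cotangent_atlas A) (liouville_form A) a b \<gamma> 0)"


section \<open>Semi-concave functions and enlarged pseudographs\<close>

definition superdifferential ::
    "real \<Rightarrow> 'e::euclidean_space set \<Rightarrow> ('e \<Rightarrow> real) \<Rightarrow> 'e \<Rightarrow> ('e \<Rightarrow> real) set" where
  "superdifferential K U w x = {p. linear p \<and>
     (\<forall>y\<in>U. w y \<le> w x + p (y - x) + K * (norm (y - x))\<^sup>2)}"

definition semiconcave_on :: "real \<Rightarrow> 'e::euclidean_space set \<Rightarrow> ('e \<Rightarrow> real) \<Rightarrow> bool" where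
  "semiconcave_on K U w \<longleftrightarrow> K \<ge> 0 \<and> (\<forall>x\<in>U. superdifferential K U w x \<noteq> {})"

definition semiconcave ::
    "('a, 'e::euclidean_space) chart set \<Rightarrow> real \<Rightarrow> ('a \<Rightarrow> real) \<Rightarrow> bool" where
  "semiconcave A K u \<longleftrightarrow> K \<ge> 0 \<and> (\<forall>c\<in>A. semiconcave_on K (snd c ` fst c) (u \<circ> chart_inv c))"

definition enlarged_pseudograph ::
    "('a, 'e::euclidean_space) chart set \<Rightarrow> real \<Rightarrow> ('a \<Rightarrow> real) \<Rightarrow> ('a, 'e) covector set" where
  "enlarged_pseudograph A K u =
     {(x, restrict (\<lambda>v. p (v c)) (tangent_space A x)) | x c p. c \<in> charts_at A x \<and>
        p \<in> superdifferential K (snd c ` fst c) (u \<circ> chart_inv c) (snd c x)}"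

end

theory Submission
  imports Defs
begin

text \<open>Write \<open>w\<close> for the function \<open>u\<close> read in a chart, a \<open>K\<close>-semi-concave function on an open set \<open>W\<close>.
The inequality that defines a \<open>K\<close>-super-differential of \<open>w\<close> at \<open>y\<close> involves all of \<open>W\<close>, and so
depends on the chart and on \<open>K\<close>. The first point is that it is in fact a condition on the germ of
\<open>w\<close> at \<open>y\<close>: a linear form that satisfies it up to \<open>o(\<parallel>z - y\<parallel>)\<close> satisfies it on \<open>W\<close>
(\<open>frechet_super_imp_superdifferential\<close>). Germs are transported by the transition maps, hence in
the coordinates of any chart the pseudograph consists of \<^emph>\<open>all\<close> the super-differentials of \<open>w\<close>
(\<open>pseudograph_in_chart\<close>), also of those that came from the other charts.

It is a Lipschitz submanifold by Minty's argument. The function \<open>v = K \<parallel>\<cdot>\<parallel>\<^sup>2 - w\<close> is locally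
convex, and \<open>q\<close> is a super-differential of \<open>w\<close> at \<open>y\<close> iff \<open>2 K y - q\<close> is a subgradient of \<open>v\<close>.
Subgradients are monotone, so in the linear coordinates \<open>(y + (2 K y - q), y)\<close> the pseudograph is
the graph of the resolvent \<open>(I + \<partial>v)\<^sup>-\<^sup>1\<close>, which is \<open>1\<close>-Lipschitz (\<open>minty_lipschitz\<close>). Its domain
is open (\<open>minty_open\<close>), because a point \<open>a\<close> lies in it as soon as \<open>v + \<parallel>\<cdot>\<parallel>\<^sup>2 / 2 - a \<bullet> (\<cdot>)\<close> has a
local minimum in \<open>W\<close>, and a strict minimum survives small changes of \<open>a\<close>.

It is exact because \<open>u\<close> is a primitive of the Liouville form on it. Let \<open>(y(t), q(t))\<close> be a
Lipschitz arc in the pseudograph, in coordinates. The inequalities of the super-differentials at the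
times \<open>t\<close> and \<open>s\<close> enclose \<open>w(y(s)) - w(y(t))\<close> between two numbers that differ by \<open>O((s - t)\<^sup>2)\<close>, so
\<open>w(y(t))\<close> has the derivative \<open>q(t) \<bullet> y'(t)\<close>, the value of the Liouville form on the velocity, at
every time at which \<open>y\<close> is differentiable (\<open>arc_derivative\<close>). Moreover \<open>w(y(t))\<close> is a Lipschitz
function of \<open>t\<close>, and Lipschitz functions are differentiable almost everywhere and are the integrals
of their derivatives (\<open>lipschitz_has_integral_derivative\<close>). Hence the integral of the Liouville form
along the arc is the difference of the values of \<open>u\<close> at its end points (\<open>arc_integral\<close>).\<close>


section \<open>Smooth maps\<close>

lemma Ck_on_cong:
  assumes "open S" "\<And>x. x \<in> S \<Longrightarrow> f x = g x"
  shows "Ck_on k S f \<longleftrightarrow> Ck_on k S g"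
  using assms(2)
proof (induction k arbitrary: f g)
  case 0
  then show ?case by (simp cong: continuous_on_cong)
next
  case (Suc k)
  have d: "f differentiable (at x) \<longleftrightarrow> g differentiable (at x)" if "x \<in> S" for x
    unfolding differentiable_def
    using has_derivative_transform_within_open[of _ _ x UNIV S] Suc.prems that assms(1)
    by (metis (mono_tags, lifting))
  have fd: "frechet_derivative f (at x) v = frechet_derivative g (at x) v"
    if "x \<in> S" "f differentiable (at x)" for x v
    using frechet_derivative_transform_within_open[of f x S g] Suc.prems that assms(1) by auto
  show ?case
  proof (cases "\<forall>x\<in>S. f differentiable (at x)")
    case True
    have "Ck_on k S (\<lambda>x. frechet_derivative f (at x) v)
      \<longleftrightarrow> Ck_on k S (\<lambda>x. frechet_derivative g (at x) v)" for v
      by (rule Suc.IH) (use True fd in auto)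
    then show ?thesis using d by auto
  next
    case False
    then show ?thesis using d by auto
  qed
qed

text \<open>Unlike the definition, this does not mention \<open>frechet_derivative\<close>: any explicit formula for the
derivative will do.\<close>

lemma Ck_on_SucI:
  assumes "open S" "\<And>x. x \<in> S \<Longrightarrow> (f has_derivative f' x) (at x)"
    and "\<And>v. Ck_on k S (\<lambda>x. f' x v)"
  shows "Ck_on (Suc k) S f"
proof -
  have fd: "frechet_derivative f (at x) = f' x" if "x \<in> S" for x
    using frechet_derivative_at[OF assms(2)[OF that]] by simp
  have "Ck_on k S (\<lambda>x. frechet_derivative f (at x) v)" for v
    using Ck_on_cong[OF assms(1), of "\<lambda>x. frechet_derivative f (at x) v" "\<lambda>x. f' x v" k]
      assms(3) fd by simp
  then show ?thesis
    using assms(2) by (auto simp: differentiable_def)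
qed

lemma Ck_on_SucD:
  assumes "Ck_on (Suc k) S f" "x \<in> S"
  shows "(f has_derivative frechet_derivative f (at x)) (at x)"
  using assms by (auto simp: frechet_derivative_works)

lemma Ck_on_pred: "Ck_on (Suc k) S f \<Longrightarrow> Ck_on k S f"
proof (induction k arbitrary: f)
  case 0
  then show ?case
    by (auto intro!: differentiable_imp_continuous_on simp: differentiable_on_def differentiable_at_withinI)
next
  case (Suc k)
  then show ?case by (metis Ck_on.simps(2))
qed

lemma Ck_on_const: "open S \<Longrightarrow> Ck_on k S (\<lambda>x. c)"
proof (induction k arbitrary: c)
  case (Suc k)
  then show ?case by (intro Ck_on_SucI[where f'="\<lambda>_ _. 0"]) auto
qed simp

lemma Ck_on_bounded_linear:
  assumes "bounded_linear L" "open S"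
  shows "Ck_on k S L"
proof (cases k)
  case 0
  then show ?thesis using assms by (simp add: linear_continuous_on)
next
  case (Suc n)
  then show ?thesis
    using assms Ck_on_SucI[of S L "\<lambda>_. L" n] by (simp add: Ck_on_const bounded_linear_imp_has_derivative del: Ck_on.simps)
qed

lemma Ck_on_add:
  assumes "open S"
  shows "Ck_on k S f \<Longrightarrow> Ck_on k S g \<Longrightarrow> Ck_on k S (\<lambda>x. f x + g x)"
proof (induction k arbitrary: f g)
  case 0
  then show ?case by (simp add: continuous_on_add)
next
  case (Suc k)
  show ?case
    by (rule Ck_on_SucI[OF assms,
          where f'="\<lambda>x v. frechet_derivative f (at x) v + frechet_derivative g (at x) v"])
      (use Suc in \<open>auto intro!: has_derivative_add Ck_on_SucD\<close>)
qed

lemma Ck_on_sum: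
  assumes "open S" "finite I" "\<And>i. i \<in> I \<Longrightarrow> Ck_on k S (f i)"
  shows "Ck_on k S (\<lambda>x. \<Sum>i\<in>I. f i x)"
  using assms(2,3) by (induction I) (auto intro: Ck_on_const Ck_on_add assms(1))

lemma Ck_on_bilinear:
  assumes "bounded_bilinear h" "open S"
  shows "Ck_on k S f \<Longrightarrow> Ck_on k S g \<Longrightarrow> Ck_on k S (\<lambda>x. h (f x) (g x))"
proof (induction k arbitrary: f g)
  case 0
  then show ?case by (simp add: bounded_bilinear.continuous_on[OF assms(1)])
next
  case (Suc k)
  have "Ck_on k S f" "Ck_on k S g"
    using Suc.prems Ck_on_pred by blast+
  moreover have "Ck_on k S (\<lambda>x. frechet_derivative f (at x) v)"
    "Ck_on k S (\<lambda>x. frechet_derivative g (at x) v)" for v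
    using Suc.prems by simp_all
  ultimately show ?case
    by (intro Ck_on_SucI[OF assms(2),
          where f'="\<lambda>x v. h (f x) (frechet_derivative g (at x) v) + h (frechet_derivative f (at x) v) (g x)"])
      (auto intro!: bounded_bilinear.FDERIV[OF assms(1)] Ck_on_SucD Suc Ck_on_add assms)
qed

lemma linear_eq_sum_Basis:
  fixes L :: "'a::euclidean_space \<Rightarrow> 'b::real_vector"
  assumes "linear L"
  shows "L v = (\<Sum>b\<in>Basis. (v \<bullet> b) *\<^sub>R L b)"
  by (metis (no_types, lifting) assms euclidean_representation linear_sum linear_scale sum.cong)

lemma Ck_on_compose:
  fixes f :: "'a::real_normed_vector \<Rightarrow> 'b::euclidean_space" and g :: "'b \<Rightarrow> 'c::real_normed_vector"
  assumes "open S" "open T" "f ` S \<subseteq> T"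
  shows "Ck_on k S f \<Longrightarrow> Ck_on k T g \<Longrightarrow> Ck_on k S (\<lambda>x. g (f x))"
proof (induction k arbitrary: g)
  case 0
  then show ?case using continuous_on_compose2[of T g S f] assms by simp
next
  case (Suc k)
  have f: "Ck_on k S f"
    using Suc.prems Ck_on_pred by blast
  have dg: "Ck_on k S (\<lambda>x. frechet_derivative g (at (f x)) b)" for b
    using Suc.IH[of "\<lambda>y. frechet_derivative g (at y) b"] f Suc.prems by simp
  have D: "((\<lambda>x. g (f x)) has_derivative
     (\<lambda>v. frechet_derivative g (at (f x)) (frechet_derivative f (at x) v))) (at x)" if "x \<in> S" for x
    using has_derivative_compose[OF Ck_on_SucD[OF Suc.prems(1) that] Ck_on_SucD[OF Suc.prems(2)]]
      that assms(3) by auto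
  \<comment> \<open>The chain rule, expanded in the basis so that the induction hypothesis applies to each factor.\<close>
  have E: "frechet_derivative g (at (f x)) (frechet_derivative f (at x) v) =
     (\<Sum>b\<in>Basis. (frechet_derivative f (at x) v \<bullet> b) *\<^sub>R frechet_derivative g (at (f x)) b)"
    if "x \<in> S" for x v
    using linear_eq_sum_Basis[OF has_derivative_linear[OF Ck_on_SucD[OF Suc.prems(2)]]] that assms(3)
    by blast
  have "Ck_on k S (\<lambda>x. frechet_derivative f (at x) v)" for v
    using Suc.prems by simp
  then have "Ck_on k S (\<lambda>x. frechet_derivative f (at x) v \<bullet> b)" for v b
    by (intro Ck_on_bilinear[OF bounded_bilinear_inner] Ck_on_const assms)
  then have "Ck_on k S (\<lambda>x. \<Sum>b\<in>Basis. (frechet_derivative f (at x) v \<bullet> b) *\<^sub>R frechet_derivative g (at (f x)) b)" for v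
    by (intro Ck_on_sum Ck_on_bilinear[OF bounded_bilinear_scaleR] dg assms) auto
  then have "Ck_on k S (\<lambda>x. frechet_derivative g (at (f x)) (frechet_derivative f (at x) v))" for v
    using Ck_on_cong[OF assms(1) E] by simp
  then show ?case using Ck_on_SucI[OF assms(1) D] by blast
qed

lemma Ck_on_Pair:
  assumes "open S"
  shows "Ck_on k S f \<Longrightarrow> Ck_on k S g \<Longrightarrow> Ck_on k S (\<lambda>x. (f x, g x))"
proof (induction k arbitrary: f g)
  case 0
  then show ?case by (simp add: continuous_on_Pair)
next
  case (Suc k)
  show ?case
    by (rule Ck_on_SucI[OF assms,
          where f'="\<lambda>x v. (frechet_derivative f (at x) v, frechet_derivative g (at x) v)"])
      (use Suc in \<open>auto intro!: has_derivative_Pair Ck_on_SucD\<close>)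
qed

lemma smooth_on_cong:
  "open S \<Longrightarrow> (\<And>x. x \<in> S \<Longrightarrow> f x = g x) \<Longrightarrow> smooth_on S f \<longleftrightarrow> smooth_on S g"
  unfolding smooth_on_def using Ck_on_cong by blast

lemma smooth_on_bounded_linear: "bounded_linear L \<Longrightarrow> open S \<Longrightarrow> smooth_on S L"
  unfolding smooth_on_def using Ck_on_bounded_linear by blast

lemma smooth_on_compose:
  fixes f :: "'a::real_normed_vector \<Rightarrow> 'b::euclidean_space" and g :: "'b \<Rightarrow> 'c::real_normed_vector"
  assumes "open S" "open T" "f ` S \<subseteq> T" "smooth_on S f" "smooth_on T g"
  shows "smooth_on S (\<lambda>x. g (f x))"
  using assms Ck_on_compose unfolding smooth_on_def by blast

lemma smooth_on_frechet_derivative: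
  "smooth_on S f \<Longrightarrow> smooth_on S (\<lambda>x. frechet_derivative f (at x) v)"
  unfolding smooth_on_def using Ck_on.simps(2) by blast

lemma smooth_on_has_derivative:
  "smooth_on S f \<Longrightarrow> x \<in> S \<Longrightarrow> (f has_derivative frechet_derivative f (at x)) (at x)"
  unfolding smooth_on_def using Ck_on_SucD by blast

lemma smooth_on_continuous_on: "smooth_on S f \<Longrightarrow> continuous_on S f"
  unfolding smooth_on_def by (metis Ck_on.simps(1))

text \<open>The operator norm of the derivative is bounded by the sum of the norms of the partial derivatives,
and these are continuous, hence bounded on a compact ball.\<close>

lemma smooth_on_locally_lipschitz:
  fixes f :: "'a::euclidean_space \<Rightarrow> 'b::real_normed_vector"
  assumes "open S" "smooth_on S f" "x \<in> S"
  obtains r M where "r > 0" "cball x r \<subseteq> S" "M-lipschitz_on (cball x r) f"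
proof -
  obtain r where r: "r > 0" "cball x r \<subseteq> S"
    using assms open_contains_cball by blast
  define g where "g b y = frechet_derivative f (at y) b" for b y
  have "\<exists>M. \<forall>y\<in>cball x r. norm (g b y) \<le> M" for b
  proof -
    have "continuous_on (cball x r) (g b)"
      unfolding g_def using smooth_on_continuous_on[OF smooth_on_frechet_derivative[OF assms(2)]]
        continuous_on_subset r(2) by blast
    then have "bounded (g b ` cball x r)"
      by (intro compact_imp_bounded compact_continuous_image) auto
    then show ?thesis by (auto simp: bounded_iff)
  qed
  then obtain M where M: "\<And>b y. y \<in> cball x r \<Longrightarrow> norm (g b y) \<le> M b"
    by metis
  define C where "C = (\<Sum>b\<in>Basis. M b)"
  have D: "(f has_derivative frechet_derivative f (at y)) (at y)" if "y \<in> cball x r" for y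
    using smooth_on_has_derivative[OF assms(2)] that r by blast
  have C: "norm (frechet_derivative f (at y) v) \<le> C * norm v" if "y \<in> cball x r" for y v
  proof -
    have "frechet_derivative f (at y) v = (\<Sum>b\<in>Basis. (v \<bullet> b) *\<^sub>R g b y)"
      unfolding g_def by (rule linear_eq_sum_Basis[OF has_derivative_linear[OF D[OF that]]])
    also have "norm \<dots> \<le> (\<Sum>b\<in>Basis. norm v * M b)"
      by (rule sum_norm_le) (auto intro!: mult_mono M that Basis_le_norm)
    finally show ?thesis by (simp add: C_def sum_distrib_left mult.commute)
  qed
  have C0: "0 \<le> C"
    unfolding C_def by (rule sum_nonneg) (metis M centre_in_cball less_imp_le r(1) norm_ge_zero order_trans)
  have "C-lipschitz_on (cball x r) f"
  proof (rule lipschitz_onI[OF _ C0])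
    fix y z assume yz: "y \<in> cball x r" "z \<in> cball x r"
    have "norm (f y - f z) \<le> C * norm (y - z)"
    proof (rule differentiable_bound[where S="cball x r" and f'="\<lambda>y. frechet_derivative f (at y)"])
      show "(f has_derivative frechet_derivative f (at y)) (at y within cball x r)"
        if "y \<in> cball x r" for y
        using D[OF that] has_derivative_at_withinI by blast
      show "onorm (frechet_derivative f (at y)) \<le> C" if "y \<in> cball x r" for y
        using C[OF that] C0 by (intro onorm_bound) auto
    qed (use yz in auto)
    then show "dist (f y) (f z) \<le> C * dist y z" by (simp add: dist_norm)
  qed
  with r that show ?thesis by blast
qed

lemma smooth_on_const: "open S \<Longrightarrow> smooth_on S (\<lambda>x. c)"
  unfolding smooth_on_def using Ck_on_const by blast

lemma smooth_on_Pair: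
  "open S \<Longrightarrow> smooth_on S f \<Longrightarrow> smooth_on S g \<Longrightarrow> smooth_on S (\<lambda>x. (f x, g x))"
  unfolding smooth_on_def using Ck_on_Pair by blast

lemma smooth_on_sum:
  "open S \<Longrightarrow> finite I \<Longrightarrow> (\<And>i. smooth_on S (f i)) \<Longrightarrow> smooth_on S (\<lambda>x. \<Sum>i\<in>I. f i x)"
  unfolding smooth_on_def using Ck_on_sum by blast

lemma smooth_on_inner:
  "open S \<Longrightarrow> smooth_on S f \<Longrightarrow> smooth_on S g \<Longrightarrow> smooth_on S (\<lambda>x. f x \<bullet> g x)"
  unfolding smooth_on_def using Ck_on_bilinear[OF bounded_bilinear_inner] by blast

lemma smooth_on_scaleR:
  "open S \<Longrightarrow> smooth_on S f \<Longrightarrow> smooth_on S g \<Longrightarrow> smooth_on S (\<lambda>x. f x *\<^sub>R g x)"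
  unfolding smooth_on_def using Ck_on_bilinear[OF bounded_bilinear_scaleR] by blast


section \<open>Super-differentials of semi-concave functions\<close>

text \<open>The super-differentials of non-smooth analysis. They depend on the germ of \<open>w\<close> at \<open>x\<close> only and
involve no constant, and serve to compare the super-differentials of \<open>u\<close> in different charts.\<close>

definition frechet_super :: "('e::euclidean_space \<Rightarrow> real) \<Rightarrow> 'e \<Rightarrow> ('e \<Rightarrow> real) \<Rightarrow> bool" where
  "frechet_super w x p \<longleftrightarrow> linear p \<and>
     (\<forall>\<epsilon>>0. \<forall>\<^sub>F y in nhds x. w y \<le> w x + p (y - x) + \<epsilon> * norm (y - x))"

lemma superdifferential_imp_frechet_super:
  assumes "open U" "x \<in> U" "p \<in> superdifferential K U w x"
  shows "frechet_super w x p"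
  unfolding frechet_super_def
proof (intro conjI allI impI)
  show "linear p" using assms by (simp add: superdifferential_def)
  fix \<epsilon> :: real assume \<epsilon>: "\<epsilon> > 0"
  have "\<forall>\<^sub>F y in nhds x. y \<in> U"
    using assms eventually_nhds by blast
  moreover have "((\<lambda>y. \<bar>K\<bar> * norm (y - x)) \<longlongrightarrow> \<bar>K\<bar> * norm (x - x)) (nhds x)"
    by (intro tendsto_intros filterlim_ident)
  then have "\<forall>\<^sub>F y in nhds x. \<bar>K\<bar> * norm (y - x) < \<epsilon>"
    using \<epsilon> by (intro order_tendstoD(2)) auto
  ultimately show "\<forall>\<^sub>F y in nhds x. w y \<le> w x + p (y - x) + \<epsilon> * norm (y - x)"
  proof eventually_elim
    case (elim y)
    have "K * (norm (y - x))\<^sup>2 \<le> (\<bar>K\<bar> * norm (y - x)) * norm (y - x)"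
      by (simp add: power2_eq_square mult_right_mono flip: mult.assoc)
    also have "\<dots> \<le> \<epsilon> * norm (y - x)"
      using elim by (intro mult_right_mono) auto
    finally show ?case using elim assms(3) by (force simp: superdifferential_def)
  qed
qed

text \<open>The exact defect of convexity of the squared norm. It is why the error term in
\<open>superdifferential_segment\<close> expresses the convexity of \<open>K \<parallel>\<cdot>\<parallel>\<^sup>2 - w\<close> along a segment.\<close>

lemma norm_sq_segment:
  fixes x y :: "'a::real_inner"
  shows "(1 - t) * (norm x)\<^sup>2 + t * (norm y)\<^sup>2
    = (norm ((1 - t) *\<^sub>R x + t *\<^sub>R y))\<^sup>2 + t * (1 - t) * (norm (y - x))\<^sup>2"
  unfolding power2_norm_eq_inner by (simp add: inner_simps inner_commute[of y x] algebra_simps)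

text \<open>The rest of the segment may leave \<open>U\<close>: the convexity inequality is the sum, with weights \<open>1 - t\<close> and \<open>t\<close>, of the defining
inequalities at \<open>x\<close> and at \<open>y\<close>, in which the linear terms cancel. This is what makes non-convex
domains harmless.\<close>

lemma superdifferential_segment:
  assumes p: "p \<in> superdifferential K U w z" and z: "z = x + t *\<^sub>R (y - x)"
    and "x \<in> U" "y \<in> U" "0 \<le> t" "t \<le> 1"
  shows "(1 - t) * w x + t * w y \<le> w z + K * t * (1 - t) * (norm (y - x))\<^sup>2"
proof -
  have lin: "linear p" using p by (simp add: superdifferential_def)
  have "x - z = (- t) *\<^sub>R (y - x)" "y - z = (1 - t) *\<^sub>R (y - x)"
    using z by (auto simp: algebra_simps)
  then have e: "p (x - z) = - t * p (y - x)" "p (y - z) = (1 - t) * p (y - x)"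
    "(norm (x - z))\<^sup>2 = t\<^sup>2 * (norm (y - x))\<^sup>2" "(norm (y - z))\<^sup>2 = (1 - t)\<^sup>2 * (norm (y - x))\<^sup>2"
    by (simp_all add: linear_scale[OF lin] power_mult_distrib del: scaleR_left_diff_distrib scaleR_minus_left)
  have "w x \<le> w z + p (x - z) + K * (norm (x - z))\<^sup>2" "w y \<le> w z + p (y - z) + K * (norm (y - z))\<^sup>2"
    using p \<open>x \<in> U\<close> \<open>y \<in> U\<close> by (auto simp: superdifferential_def)
  then have "w x \<le> w z - t * p (y - x) + K * (t\<^sup>2 * (norm (y - x))\<^sup>2)"
    "w y \<le> w z + (1 - t) * p (y - x) + K * ((1 - t)\<^sup>2 * (norm (y - x))\<^sup>2)"
    unfolding e by simp_all
  then have "(1 - t) * w x \<le> (1 - t) * (w z - t * p (y - x) + K * (t\<^sup>2 * (norm (y - x))\<^sup>2))"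
    "t * w y \<le> t * (w z + (1 - t) * p (y - x) + K * ((1 - t)\<^sup>2 * (norm (y - x))\<^sup>2))"
    using \<open>0 \<le> t\<close> \<open>t \<le> 1\<close> by (intro mult_left_mono; simp)+
  then have "(1 - t) * w x + t * w y \<le> (1 - t) * (w z - t * p (y - x) + K * (t\<^sup>2 * (norm (y - x))\<^sup>2))
     + t * (w z + (1 - t) * p (y - x) + K * ((1 - t)\<^sup>2 * (norm (y - x))\<^sup>2))"
    by (rule add_mono)
  also have "\<dots> = w z + K * t * (1 - t) * (norm (y - x))\<^sup>2"
    by (simp add: power2_eq_square algebra_simps)
  finally show ?thesis .
qed

text \<open>From local to global. For \<open>y \<in> U\<close> and small \<open>t > 0\<close> the point \<open>z = x + t (y - x)\<close> lies in \<open>U\<close>, and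
\<open>w\<close> has a super-differential there. Convexity along the segment at \<open>z\<close> bounds \<open>t w(y)\<close> by
\<open>w(z) - (1 - t) w(x) + K t \<parallel>y - x\<parallel>\<^sup>2\<close>, and the local condition bounds \<open>w(z)\<close> by \<open>w(x) + t p(y - x) + o(t)\<close>. Divide
by \<open>t\<close>.\<close>

lemma frechet_super_imp_superdifferential:
  assumes U: "open U" "x \<in> U" and w: "semiconcave_on K U w" and p: "frechet_super w x p"
  shows "p \<in> superdifferential K U w x"
proof -
  have lin: "linear p" using p by (simp add: frechet_super_def)
  have "w y \<le> w x + p (y - x) + K * (norm (y - x))\<^sup>2" if y: "y \<in> U" for y
  proof (rule field_le_epsilon)
    fix e :: real assume e: "0 < e"
    define \<epsilon> where "\<epsilon> = e / (norm (y - x) + 1)"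
    have \<epsilon>: "\<epsilon> > 0" "\<epsilon> * norm (y - x) \<le> e"
      using e add_nonneg_pos[OF norm_ge_zero[of "y - x"] zero_less_one]
      by (simp_all add: \<epsilon>_def field_simps)
    have lim: "filterlim (\<lambda>t. x + t *\<^sub>R (y - x)) (nhds x) (at_right (0::real))"
      by (auto intro!: tendsto_eq_intros)
    have "\<forall>\<^sub>F y in nhds x. y \<in> U"
      using U eventually_nhds by blast
    then have "\<forall>\<^sub>F z in nhds x. w z \<le> w x + p (z - x) + \<epsilon> * norm (z - x) \<and> z \<in> U"
      using p \<epsilon>(1) unfolding frechet_super_def by (simp add: eventually_conj)
    from eventually_conj[OF eventually_compose_filterlim[OF this lim] eventually_at_right_real[OF zero_less_one]]
    have "\<forall>\<^sub>F t in at_right 0. w (x + t *\<^sub>R (y - x)) \<le> w x + t * p (y - x) + \<epsilon> * (t * norm (y - x))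
        \<and> x + t *\<^sub>R (y - x) \<in> U \<and> 0 < t \<and> t < 1"
      by (rule eventually_mono) (auto simp: linear_scale[OF lin])
    then obtain t where t: "w (x + t *\<^sub>R (y - x)) \<le> w x + t * p (y - x) + \<epsilon> * (t * norm (y - x))"
        "x + t *\<^sub>R (y - x) \<in> U" "0 < t" "t < 1"
      using eventually_happens by fastforce
    obtain q where q: "q \<in> superdifferential K U w (x + t *\<^sub>R (y - x))"
      using w t(2) by (auto simp: semiconcave_on_def)
    have "K * t * (1 - t) * (norm (y - x))\<^sup>2 \<le> K * t * 1 * (norm (y - x))\<^sup>2"
      using w t by (intro mult_right_mono mult_left_mono) (auto simp: semiconcave_on_def)
    with superdifferential_segment[OF q refl U(2) y] t
    have "t * w y \<le> t * w x + t * p (y - x) + \<epsilon> * (t * norm (y - x)) + K * t * (norm (y - x))\<^sup>2"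
      by (simp add: algebra_simps)
    then have "t * w y \<le> t * (w x + p (y - x) + \<epsilon> * norm (y - x) + K * (norm (y - x))\<^sup>2)"
      by (simp add: algebra_simps)
    with t(3) have "w y \<le> w x + p (y - x) + \<epsilon> * norm (y - x) + K * (norm (y - x))\<^sup>2"
      by simp
    with \<epsilon>(2) show "w y \<le> w x + p (y - x) + K * (norm (y - x))\<^sup>2 + e" by simp
  qed
  with lin show ?thesis by (simp add: superdifferential_def)
qed

text \<open>Transport by a map that is differentiable at \<open>x\<close>: both the error of its linear approximation and
the error term of \<open>p\<close> are \<open>o(\<parallel>y - x\<parallel>)\<close>.\<close>

lemma frechet_super_compose:
  assumes p: "frechet_super w (\<phi> x) p" and D: "(\<phi> has_derivative D) (at x)"
  shows "frechet_super (\<lambda>y. w (\<phi> y)) x (\<lambda>v. p (D v))"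
  unfolding frechet_super_def
proof (intro conjI allI impI)
  have lin: "linear p" using p by (simp add: frechet_super_def)
  have bl: "bounded_linear p" using lin by (simp add: linear_conv_bounded_linear)
  have blD: "bounded_linear D" using D has_derivative_bounded_linear by blast
  show "linear (\<lambda>v. p (D v))"
    using linear_compose[OF bounded_linear.linear[OF blD] lin] by (simp add: o_def)
  obtain B where B: "B > 0" "\<And>v. norm (D v) \<le> norm v * B"
    using bounded_linear.pos_bounded[OF blD] by blast
  obtain C where C: "C > 0" "\<And>v. norm (p v) \<le> norm v * C"
    using bounded_linear.pos_bounded[OF bl] by blast
  fix e :: real assume e: "e > 0"
  define \<epsilon> where "\<epsilon> = e / 2 / (B + 1)"
  define \<eta> where "\<eta> = min 1 (e / 2 / C)"
  have pos: "\<epsilon> > 0" "\<eta> > 0" using e B C by (auto simp: \<epsilon>_def \<eta>_def)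
  have cont: "filterlim \<phi> (nhds (\<phi> x)) (nhds x)"
    using has_derivative_continuous[OF D] tendsto_at_iff_tendsto_nhds isCont_def by blast
  have "\<forall>\<^sub>F z in nhds (\<phi> x). w z \<le> w (\<phi> x) + p (z - \<phi> x) + \<epsilon> * norm (z - \<phi> x)"
    using p pos(1) by (simp add: frechet_super_def)
  from eventually_compose_filterlim[OF this cont]
  have 1: "\<forall>\<^sub>F y in nhds x. w (\<phi> y) \<le> w (\<phi> x) + p (\<phi> y - \<phi> x) + \<epsilon> * norm (\<phi> y - \<phi> x)" .
  have 2: "\<forall>\<^sub>F y in nhds x. norm (\<phi> y - \<phi> x - D (y - x)) \<le> \<eta> * norm (y - x)"
  proof -
    obtain d where "d > 0" "\<And>y. norm (y - x) < d \<Longrightarrow> norm (\<phi> y - \<phi> x - D (y - x)) \<le> \<eta> * norm (y - x)"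
      using D pos(2) unfolding has_derivative_at_alt by blast
    then show ?thesis by (auto simp: eventually_nhds_metric dist_norm)
  qed
  \<comment> \<open>The constants share \<open>e\<close>: half of it pays for the error of \<open>p\<close>, half for that of \<open>\<phi>\<close>.\<close>
  from 1 2 show "\<forall>\<^sub>F y in nhds x. w (\<phi> y) \<le> w (\<phi> x) + p (D (y - x)) + e * norm (y - x)"
  proof eventually_elim
    case (elim y)
    let ?r = "\<phi> y - \<phi> x - D (y - x)" and ?n = "norm (y - x)"
    have "p (\<phi> y - \<phi> x) = p (D (y - x)) + p ?r"
      by (simp add: linear_diff[OF lin])
    moreover have "p ?r \<le> (e / 2) * ?n"
    proof -
      have "p ?r \<le> norm ?r * C" using C(2)[of ?r] by simp
      also have "\<dots> \<le> (e / 2 / C * ?n) * C"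
        using elim(2) C(1) by (intro mult_right_mono order_trans[OF elim(2)]) (auto simp: \<eta>_def)
      finally show ?thesis using C by simp
    qed
    moreover have "\<epsilon> * norm (\<phi> y - \<phi> x) \<le> (e / 2) * ?n"
    proof -
      have "norm (\<phi> y - \<phi> x) \<le> norm (D (y - x)) + norm ?r"
        using norm_triangle_sub[of "\<phi> y - \<phi> x" "D (y - x)"] by simp
      also have "\<dots> \<le> ?n * B + 1 * ?n"
        using elim(2) B(2)[of "y - x"]
        by (intro add_mono order_trans[OF elim(2)] mult_right_mono) (auto simp: \<eta>_def)
      finally have "\<epsilon> * norm (\<phi> y - \<phi> x) \<le> \<epsilon> * ((B + 1) * ?n)"
        using pos by (intro mult_left_mono) (auto simp: algebra_simps)
      also have "\<dots> = (e / 2) * ?n" using B by (simp add: \<epsilon>_def field_simps)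
      finally show ?thesis .
    qed
    ultimately show ?case using elim(1) by (simp add: algebra_simps)
  qed
qed

lemma frechet_super_cong:
  assumes "frechet_super w x p" "\<forall>\<^sub>F y in nhds x. w y = w' y"
  shows "frechet_super w' x p"
proof -
  have x: "w x = w' x" using eventually_nhds_x_imp_x[OF assms(2)] .
  have "\<forall>\<^sub>F y in nhds x. w' y \<le> w' x + p (y - x) + \<epsilon> * norm (y - x)" if "\<epsilon> > 0" for \<epsilon>
  proof -
    have "\<forall>\<^sub>F y in nhds x. w y \<le> w x + p (y - x) + \<epsilon> * norm (y - x)"
      using assms(1) that by (simp add: frechet_super_def)
    with assms(2) show ?thesis by eventually_elim (use x in auto)
  qed
  with assms(1) show ?thesis by (simp add: frechet_super_def)
qed

text \<open>On every ball in \<open>U\<close> the function \<open>K \<parallel>\<cdot>\<parallel>\<^sup>2 - w\<close> is convex, hence continuous.\<close>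

lemma semiconcave_on_continuous_on:
  assumes "open U" "semiconcave_on K U w"
  shows "continuous_on U w"
proof -
  have "isCont w x" if xU: "x \<in> U" for x
  proof -
    obtain r where r: "r > 0" "ball x r \<subseteq> U"
      using openE[OF assms(1) xU] by blast
    have "convex_on (ball x r) (\<lambda>y. K * (norm y)\<^sup>2 - w y)"
    proof (rule convex_onI)
      fix t :: real and y z assume t: "0 < t" "t < 1" and yz: "y \<in> ball x r" "z \<in> ball x r"
      let ?m = "(1 - t) *\<^sub>R y + t *\<^sub>R z"
      have "?m \<in> U"
        using yz t r(2) convexD_alt[OF convex_ball] by (metis less_imp_le subsetD)
      then obtain p where p: "p \<in> superdifferential K U w ?m"
        using assms(2) unfolding semiconcave_on_def by blast
      have "(1 - t) * w y + t * w z \<le> w ?m + K * t * (1 - t) * (norm (z - y))\<^sup>2"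
        by (rule superdifferential_segment[OF p]) (use t yz r in \<open>auto simp: algebra_simps\<close>)
      moreover have "K * ((1 - t) * (norm y)\<^sup>2 + t * (norm z)\<^sup>2)
          = K * ((norm ?m)\<^sup>2 + t * (1 - t) * (norm (z - y))\<^sup>2)"
        by (simp only: norm_sq_segment)
      ultimately show "K * (norm ?m)\<^sup>2 - w ?m \<le> (1 - t) * (K * (norm y)\<^sup>2 - w y) + t * (K * (norm z)\<^sup>2 - w z)"
        by (simp add: algebra_simps)
    qed simp
    then have "continuous_on (ball x r) (\<lambda>y. K * (norm y)\<^sup>2 - w y)"
      by (intro convex_on_continuous) auto
    then have "continuous_on (ball x r) (\<lambda>y. K * (norm y)\<^sup>2 - (K * (norm y)\<^sup>2 - w y))"
      by (rule continuous_on_diff[rotated]) (intro continuous_intros)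
    then have "continuous_on (ball x r) w" by simp
    then show ?thesis using r(1) by (simp add: continuous_on_eq_continuous_at)
  qed
  then show ?thesis by (simp add: continuous_at_imp_continuous_on)
qed


section \<open>The resolvent of the super-differential\<close>

lemma superdifferential_increment_bounds:
  assumes "q \<in> superdifferential K U w x" "q' \<in> superdifferential K U w y" "x \<in> U" "y \<in> U"
  shows "w y - w x \<le> q (y - x) + K * (norm (y - x))\<^sup>2"
    and "q' (y - x) - K * (norm (y - x))\<^sup>2 \<le> w y - w x"
proof -
  have "w y \<le> w x + q (y - x) + K * (norm (y - x))\<^sup>2" "w x \<le> w y + q' (x - y) + K * (norm (x - y))\<^sup>2"
    using assms by (auto simp: superdifferential_def)
  moreover have "q' (x - y) = - q' (y - x)"
    using linear_neg[of q' "y - x"] assms(2) by (simp add: superdifferential_def)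
  ultimately show "w y - w x \<le> q (y - x) + K * (norm (y - x))\<^sup>2"
    and "q' (y - x) - K * (norm (y - x))\<^sup>2 \<le> w y - w x"
    by (simp_all add: norm_minus_commute)
qed

text \<open>Equivalently, the subgradients \<open>2 K x - p\<close> of \<open>K \<parallel>\<cdot>\<parallel>\<^sup>2 - w\<close> form a monotone relation.\<close>

lemma superdifferential_monotone:
  assumes "p \<in> superdifferential K U w x" "q \<in> superdifferential K U w y" "x \<in> U" "y \<in> U"
  shows "p (x - y) - q (x - y) \<le> 2 * K * (norm (x - y))\<^sup>2"
  using superdifferential_increment_bounds[OF assms(2,1,4,3)] by linarith

text \<open>Let \<open>v = K \<parallel>\<cdot>\<parallel>\<^sup>2 - w\<close>; the set is the range of \<open>I + \<partial>v\<close> over \<open>U\<close>. If \<open>y\<^sub>0\<close> belongs to it, with the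
base point \<open>x\<^sub>0\<close>, then \<open>v + \<parallel>\<cdot>\<parallel>\<^sup>2 / 2 - y\<^sub>0 \<bullet> (\<cdot>)\<close> exceeds its value at \<open>x\<^sub>0\<close> by at least
\<open>\<parallel>x - x\<^sub>0\<parallel>\<^sup>2 / 2\<close>. For \<open>y\<close> close to \<open>y\<^sub>0\<close> the function \<open>v + \<parallel>\<cdot>\<parallel>\<^sup>2 / 2 - y \<bullet> (\<cdot>)\<close> therefore has an
interior minimum \<open>x\<^sub>1\<close> on a small ball around \<open>x\<^sub>0\<close>. Stationarity there means that \<open>y - x\<^sub>1\<close> is a
subgradient of \<open>v\<close> at \<open>x\<^sub>1\<close>, first in the local sense and then globally.\<close>

lemma minty_open:
  fixes U :: "'e::euclidean_space set"
  assumes U: "open U" and w: "semiconcave_on K U w"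
  shows "open {(2 * K + 1) *\<^sub>R x - p | x p. x \<in> U \<and> (\<lambda>h. p \<bullet> h) \<in> superdifferential K U w x}"
    (is "open ?V")
  unfolding open_contains_ball
proof
  fix y0 assume "y0 \<in> ?V"
  then obtain x0 p0 where y0: "y0 = (2 * K + 1) *\<^sub>R x0 - p0" and x0: "x0 \<in> U"
    and p0: "(\<lambda>h. p0 \<bullet> h) \<in> superdifferential K U w x0" by blast
  obtain r where r: "r > 0" "cball x0 r \<subseteq> U"
    using open_contains_cball_eq[OF U] x0 by blast
  have "ball y0 (r / 2) \<subseteq> ?V"
  proof
    fix y assume "y \<in> ball y0 (r / 2)"
    then have y: "norm (y - y0) < r / 2" by (simp add: dist_norm norm_minus_commute)
    define f where "f x = (K + 1 / 2) * (norm x)\<^sup>2 - w x - y \<bullet> x" for x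
    have "continuous_on (cball x0 r) f"
      unfolding f_def using semiconcave_on_continuous_on[OF U w] r(2)
      by (intro continuous_intros) (auto intro: continuous_on_subset)
    then obtain x1 where x1: "x1 \<in> cball x0 r" "\<And>x. x \<in> cball x0 r \<Longrightarrow> f x1 \<le> f x"
      using continuous_attains_inf[of "cball x0 r" f] r(1) by auto
    have nn: "(norm x)\<^sup>2 = (norm x0)\<^sup>2 + 2 * (x0 \<bullet> (x - x0)) + (norm (x - x0))\<^sup>2" for x x0 :: 'e
      by (simp add: power2_norm_eq_inner inner_simps inner_commute)
    have grow: "f x0 + norm (x - x0) * (norm (x - x0) / 2 - norm (y - y0)) \<le> f x" if "x \<in> U" for x
    proof -
      have "w x \<le> w x0 + p0 \<bullet> (x - x0) + K * (norm (x - x0))\<^sup>2"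
        using p0 that by (simp add: superdifferential_def)
      moreover have "(y - y0) \<bullet> (x - x0) \<le> norm (y - y0) * norm (x - x0)"
        by (rule norm_cauchy_schwarz)
      moreover have "(y - y0) \<bullet> (x - x0) = y \<bullet> x - y \<bullet> x0 - (2 * K + 1) * (x0 \<bullet> (x - x0)) + p0 \<bullet> (x - x0)"
        by (simp add: y0 inner_simps algebra_simps)
      ultimately show ?thesis unfolding f_def nn[of x x0]
        by (simp add: algebra_simps power2_eq_square)
    qed
    have "norm (x1 - x0) < r"
    proof (rule ccontr)
      assume "\<not> norm (x1 - x0) < r"
      then have "norm (x1 - x0) = r" using x1(1) by (simp add: dist_norm norm_minus_commute)
      moreover have "0 < r * (r / 2 - norm (y - y0))"
        using r(1) y by (intro mult_pos_pos) auto
      ultimately have "f x0 < f x1"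
        using grow[of x1] x1(1) r(2) by auto
      then show False using x1(2)[of x0] r(1) by simp
    qed
    define p1 where "p1 = (2 * K + 1) *\<^sub>R x1 - y"
    have x1U: "x1 \<in> U" using x1(1) r(2) by blast
    \<comment> \<open>Minimality at \<open>x1\<close> gives the defining inequality only with the larger constant \<open>K + 1 / 2\<close>,
      and only on the ball; being local, it nevertheless yields a \<open>K\<close>-super-differential on \<open>U\<close>.\<close>
    have "(\<lambda>h. p1 \<bullet> h) \<in> superdifferential (K + 1 / 2) (ball x0 r) w x1"
      unfolding superdifferential_def
    proof (clarsimp simp: bounded_linear.linear[OF bounded_linear_inner_right])
      fix x assume "dist x0 x < r"
      then have "f x1 \<le> f x" using x1(2) by simp
      then show "w x \<le> w x1 + p1 \<bullet> (x - x1) + (K + 1 / 2) * (norm (x - x1))\<^sup>2"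
        unfolding f_def nn[of x x1] p1_def by (simp add: algebra_simps inner_simps)
    qed
    then have "frechet_super w x1 (\<lambda>h. p1 \<bullet> h)"
      using \<open>norm (x1 - x0) < r\<close>
      by (intro superdifferential_imp_frechet_super[of "ball x0 r"]) (auto simp: dist_norm norm_minus_commute)
    then have "(\<lambda>h. p1 \<bullet> h) \<in> superdifferential K U w x1"
      using frechet_super_imp_superdifferential[OF U x1U w] by blast
    moreover have "y = (2 * K + 1) *\<^sub>R x1 - p1" by (simp add: p1_def)
    ultimately show "y \<in> ?V" using x1U by blast
  qed
  then show "\<exists>e>0. ball y0 e \<subseteq> ?V" using r(1) by (intro exI[of _ "r / 2"]) auto
qed

text \<open>If \<open>r, s\<close> are subgradients at \<open>x, y\<close>, then monotonicity gives
\<open>\<parallel>x - y\<parallel>\<^sup>2 \<le> ((x + r) - (y + s)) \<bullet> (x - y)\<close>; apply the Cauchy-Schwarz inequality.\<close>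

lemma minty_lipschitz:
  fixes U :: "'e::euclidean_space set"
  assumes x: "x \<in> U" "(\<lambda>h. p \<bullet> h) \<in> superdifferential K U w x"
    and y: "y \<in> U" "(\<lambda>h. q \<bullet> h) \<in> superdifferential K U w y"
  shows "norm (x - y) \<le> norm (((2 * K + 1) *\<^sub>R x - p) - ((2 * K + 1) *\<^sub>R y - q))"
    (is "_ \<le> norm ?d")
proof (cases "x = y")
  case False
  have "(norm (x - y))\<^sup>2 \<le> ?d \<bullet> (x - y)"
    using superdifferential_monotone[OF x(2) y(2) x(1) y(1)]
    by (simp add: power2_norm_eq_inner inner_simps algebra_simps)
  also have "\<dots> \<le> norm ?d * norm (x - y)" by (rule norm_cauchy_schwarz)
  finally show ?thesis using False by (simp add: power2_eq_square)
qed simp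


section \<open>Semi-concave functions along curves of super-differentials\<close>

text \<open>The super-differential at \<open>x\<close> bounds \<open>w y - w x\<close> from above and the one at \<open>y\<close> from below; the two bounds differ by \<open>(q - p) \<bullet> (y - x)\<close> and two quadratic terms, all of second order in \<open>\<delta>\<close>.\<close>

lemma superdifferential_curve_remainder:
  assumes "0 \<le> K"
    and "(\<lambda>h. p \<bullet> h) \<in> superdifferential K U w x" "(\<lambda>h. q \<bullet> h) \<in> superdifferential K U w y" "x \<in> U" "y \<in> U"
    and C: "norm (y - x) \<le> C * \<delta>" "norm (q - p) \<le> C * \<delta>"
  shows "\<bar>w y - w x - p \<bullet> (y - x)\<bar> \<le> (C\<^sup>2 + K * C\<^sup>2) * \<delta>\<^sup>2"
proof -
  note b = superdifferential_increment_bounds[OF assms(2-5)]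
  have "\<bar>(q - p) \<bullet> (y - x)\<bar> \<le> norm (q - p) * norm (y - x)"
    by (rule Cauchy_Schwarz_ineq2)
  also have "\<dots> \<le> (C * \<delta>) * (C * \<delta>)"
    using C by (intro mult_mono) (auto intro: order_trans[OF norm_ge_zero])
  finally have 1: "\<bar>(q - p) \<bullet> (y - x)\<bar> \<le> C\<^sup>2 * \<delta>\<^sup>2" by (simp add: power2_eq_square ac_simps)
  have "K * (norm (y - x))\<^sup>2 \<le> K * (C * \<delta>)\<^sup>2"
    using C(1) assms(1) by (intro mult_left_mono power_mono) auto
  then have 2: "K * (norm (y - x))\<^sup>2 \<le> K * C\<^sup>2 * \<delta>\<^sup>2" by (simp add: power_mult_distrib)
  have 3: "0 \<le> C\<^sup>2 * \<delta>\<^sup>2" by simp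
  show ?thesis
    using b 1 2 3 unfolding abs_le_iff inner_diff_left distrib_right by linarith
qed

lemma has_real_derivative_quadratic:
  fixes f :: "real \<Rightarrow> real"
  assumes "\<forall>\<^sub>F s in nhds t. \<bar>f s\<bar> \<le> C * (s - t)\<^sup>2"
  shows "(f has_real_derivative 0) (at t)"
proof -
  have f0: "f t = 0" using eventually_nhds_x_imp_x[OF assms] by simp
  have "((\<lambda>s. (f s - f t) / (s - t)) \<longlongrightarrow> 0) (at t)"
  proof (rule Lim_null_comparison)
    show "\<forall>\<^sub>F s in at t. norm ((f s - f t) / (s - t)) \<le> C * \<bar>s - t\<bar>"
      using assms unfolding eventually_at_filter
    proof eventually_elim
      case (elim s)
      have "norm ((f s - f t) / (s - t)) \<le> C * \<bar>s - t\<bar>" if "s \<noteq> t"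
        using elim f0 that by (simp add: divide_le_eq power2_eq_square mult.assoc)
      then show ?case by simp
    qed
    have "((\<lambda>s. C * \<bar>s - t\<bar>) \<longlongrightarrow> C * \<bar>t - t\<bar>) (at t)"
      by (intro tendsto_intros)
    then show "((\<lambda>s. C * \<bar>s - t\<bar>) \<longlongrightarrow> 0) (at t)" by simp
  qed
  then show ?thesis by (simp add: has_field_derivative_iff)
qed

text \<open>A chain rule in which a Lipschitz selection \<open>q\<close> of super-differentials along the curve takes the
place of the gradient of \<open>w\<close>.\<close>

lemma superdifferential_curve_derivative:
  assumes "0 \<le> K" "open J" "t \<in> J"
    and sd: "\<And>s. s \<in> J \<Longrightarrow> y s \<in> U \<and> (\<lambda>h. q s \<bullet> h) \<in> superdifferential K U w (y s)"
    and lip: "C-lipschitz_on J y" "C-lipschitz_on J q"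
    and y: "(y has_vector_derivative v) (at t)"
  shows "((\<lambda>s. w (y s)) has_real_derivative q t \<bullet> v) (at t)"
proof -
  let ?e = "\<lambda>s. w (y s) - w (y t) - q t \<bullet> (y s - y t)"
  have "\<forall>\<^sub>F s in nhds t. s \<in> J" using assms(2,3) eventually_nhds by blast
  then have "\<forall>\<^sub>F s in nhds t. \<bar>?e s\<bar> \<le> (C\<^sup>2 + K * C\<^sup>2) * (s - t)\<^sup>2"
  proof eventually_elim
    case (elim s)
    have "\<bar>?e s\<bar> \<le> (C\<^sup>2 + K * C\<^sup>2) * \<bar>s - t\<bar>\<^sup>2"
      using sd[OF elim] sd[OF assms(3)] lipschitz_onD[OF lip(1) elim assms(3)] lipschitz_onD[OF lip(2) elim assms(3)]
      by (intro superdifferential_curve_remainder[OF assms(1)]) (auto simp: dist_norm)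
    then show ?case by simp
  qed
  then have "(?e has_real_derivative 0) (at t)" by (rule has_real_derivative_quadratic)
  moreover have "((\<lambda>s. q t \<bullet> (y s - y t)) has_real_derivative q t \<bullet> v) (at t)"
  proof -
    have "((\<lambda>s. q t \<bullet> (y s - y t)) has_vector_derivative q t \<bullet> (v - 0)) (at t)"
      by (intro bounded_linear.has_vector_derivative[OF bounded_linear_inner_right]
          has_vector_derivative_diff has_vector_derivative_const y)
    then show ?thesis by (simp add: has_real_derivative_iff_has_vector_derivative)
  qed
  ultimately have "((\<lambda>s. ?e s + q t \<bullet> (y s - y t) + w (y t)) has_real_derivative 0 + q t \<bullet> v + 0) (at t)"
    by (intro DERIV_add DERIV_const)
  then show ?thesis by simp
qed

lemma superdifferential_curve_lipschitz:
  fixes J :: "real set"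
  assumes "0 \<le> K" "bounded J"
    and sd: "\<And>s. s \<in> J \<Longrightarrow> y s \<in> U \<and> (\<lambda>h. q s \<bullet> h) \<in> superdifferential K U w (y s)"
    and lip: "C-lipschitz_on J y" "C-lipschitz_on J q"
  obtains L where "L-lipschitz_on J (\<lambda>s. w (y s))"
proof -
  have "bounded (y ` J)" "bounded (q ` J)"
    using bounded_uniformly_continuous_image[OF _ assms(2)] lip[THEN lipschitz_on_uniformly_continuous]
    by blast+
  then obtain R B where RB: "\<And>s. s \<in> J \<Longrightarrow> norm (y s) \<le> R" "\<And>s. s \<in> J \<Longrightarrow> norm (q s) \<le> B"
    unfolding bounded_iff by blast
  have C: "0 \<le> C" using lip lipschitz_on_nonneg by blast
  have *: "w (y s) - w (y r) \<le> (\<bar>B\<bar> + K * (2 * \<bar>R\<bar>)) * C * \<bar>s - r\<bar>" if J: "s \<in> J" "r \<in> J" for s r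
  proof -
    let ?d = "y s - y r"
    have "w (y s) - w (y r) \<le> q r \<bullet> ?d + K * (norm ?d)\<^sup>2"
      using superdifferential_increment_bounds(1)[of "\<lambda>h. q r \<bullet> h" K U w "y r" "\<lambda>h. q s \<bullet> h" "y s"] sd J by blast
    also have "\<dots> \<le> \<bar>B\<bar> * norm ?d + K * (2 * \<bar>R\<bar>) * norm ?d"
    proof (rule add_mono)
      show "q r \<bullet> ?d \<le> \<bar>B\<bar> * norm ?d"
        using RB(2)[OF J(2)] by (intro order_trans[OF norm_cauchy_schwarz] mult_right_mono) auto
      have "norm ?d \<le> 2 * \<bar>R\<bar>"
        using RB(1)[OF J(1)] RB(1)[OF J(2)] norm_triangle_ineq4[of "y s" "y r"] by linarith
      then have "K * norm ?d * norm ?d \<le> K * (2 * \<bar>R\<bar>) * norm ?d"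
        by (rule mult_right_mono[OF mult_left_mono[OF _ assms(1)] norm_ge_zero])
      then show "K * (norm ?d)\<^sup>2 \<le> K * (2 * \<bar>R\<bar>) * norm ?d"
        by (simp add: power2_eq_square mult.assoc)
    qed
    also have "\<dots> = (\<bar>B\<bar> + K * (2 * \<bar>R\<bar>)) * norm ?d" by (simp add: algebra_simps)
    also have "\<dots> \<le> (\<bar>B\<bar> + K * (2 * \<bar>R\<bar>)) * (C * \<bar>s - r\<bar>)"
      using lipschitz_onD[OF lip(1) J] assms(1) by (intro mult_left_mono) (auto simp: dist_norm)
    finally show ?thesis by (simp add: mult.assoc)
  qed
  have "((\<bar>B\<bar> + K * (2 * \<bar>R\<bar>)) * C)-lipschitz_on J (\<lambda>s. w (y s))"
  proof (rule lipschitz_onI)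
    show "dist (w (y s)) (w (y r)) \<le> (\<bar>B\<bar> + K * (2 * \<bar>R\<bar>)) * C * dist s r" if "s \<in> J" "r \<in> J" for s r
      using *[OF that] *[OF that(2,1)] by (simp add: dist_real_def abs_le_iff abs_minus_commute)
  qed (use C assms(1) in auto)
  then show thesis by (rule that)
qed


section \<open>Lipschitz functions of one real variable\<close>

text \<open>The image measure of Lebesgue measure under the inverse of \<open>G\<close> gives every set \<open>B\<close> the measure of
\<open>G ` B\<close>. It is absolutely continuous since \<open>G\<close> is Lipschitz, so it has a density, and the integral
of the density over an interval is the length of the image of the interval.\<close>

lemma bilipschitz_is_indefinite_integral:
  fixes G :: "real \<Rightarrow> real"
  assumes lo: "\<And>s t. s \<le> t \<Longrightarrow> t - s \<le> G t - G s"
    and hi: "\<And>s t. s \<le> t \<Longrightarrow> G t - G s \<le> M * (t - s)"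
  obtains g where "\<And>a b. a \<le> b \<Longrightarrow> (g has_integral (G b - G a)) {a..b}"
proof -
  have Gd: "\<bar>t - s\<bar> \<le> \<bar>G t - G s\<bar>" "\<bar>G t - G s\<bar> \<le> M * \<bar>t - s\<bar>" for s t
    using lo[of s t] lo[of t s] hi[of s t] hi[of t s] by (cases "s \<le> t"; simp)+
  have mono: "G s \<le> G t \<longleftrightarrow> s \<le> t" for s t
    using lo[of s t] lo[of t s] by (cases "s \<le> t") auto
  have M: "0 \<le> M" using lo[of 0 1] hi[of 0 1] by simp
  have "M-lipschitz_on UNIV G"
    using Gd(2) M by (intro lipschitz_onI) (auto simp: dist_real_def)
  then have cont: "continuous_on UNIV G" by (rule lipschitz_on_continuous_on)
  have "surj G"
    unfolding surj_def
  proof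
    fix y
    define r where "r = \<bar>y - G 0\<bar>"
    have "G (- r) \<le> y" "y \<le> G r"
      using lo[of "-r" 0] lo[of 0 r] by (auto simp: r_def)
    then show "\<exists>x. y = G x"
      using IVT'[of G "-r" y r] cont continuous_on_subset r_def by fastforce
  qed
  define H where "H = inv G"
  have GH: "G (H y) = y" for y using \<open>surj G\<close> by (simp add: H_def surj_f_inv_f)
  have HG: "H (G x) = x" for x using Gd(1)[of "H (G x)" x] GH[of "G x"] by simp
  have "1-lipschitz_on UNIV H"
    using Gd(1)[of "H _" "H _"] by (intro lipschitz_onI) (auto simp: GH dist_real_def)
  then have "continuous_on UNIV H" by (rule lipschitz_on_continuous_on)
  then have Hm: "H \<in> borel_measurable borel" by (rule borel_measurable_continuous_onI)
  define \<mu> where "\<mu> = distr lborel borel H"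
  have vim: "H -` B = G ` B" for B using GH HG by (auto simp: image_iff) metis
  have em: "emeasure \<mu> B = emeasure lborel (G ` B)" if "B \<in> sets borel" for B
    using that Hm by (simp add: \<mu>_def emeasure_distr vim)
  have "absolutely_continuous lborel \<mu>"
    unfolding absolutely_continuous_def
  proof
    fix N assume N: "N \<in> null_sets (lborel :: real measure)"
    then have "negligible N"
      by (simp add: negligible_iff_null_sets null_sets_completionI)
    then have "negligible (G ` N)"
    proof (rule negligible_locally_Lipschitz_image[OF order_refl])
      fix x assume "x \<in> N"
      show "\<exists>T B. open T \<and> x \<in> T \<and> (\<forall>y\<in>N \<inter> T. norm (G y - G x) \<le> B * norm (y - x))"
        using Gd(2) by (intro exI[of _ UNIV] exI[of _ M]) auto
    qed
    moreover have "G ` N \<in> sets borel"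
      using measurable_sets[OF Hm, of N] N by (simp add: vim null_sets_def)
    ultimately have "emeasure lborel (G ` N) = 0"
      by (simp add: negligible_iff_null_sets null_sets_def)
    then show "N \<in> null_sets \<mu>"
      using N em[of N] by (auto simp: null_sets_def \<mu>_def)
  qed
  then obtain f where f: "f \<in> borel_measurable lborel" "density lborel f = \<mu>"
    using sigma_finite_measure.Radon_Nikodym[OF sigma_finite_lborel, of \<mu>] by (auto simp: \<mu>_def)
  define g where "g x = enn2real (f x)" for x
  have g0: "0 \<le> g x" for x by (simp add: g_def)
  have gm: "g \<in> borel_measurable borel" using f(1) by (simp add: g_def[abs_def])
  have "(g has_integral (G b - G a)) {a..b}" if "a \<le> b" for a b
  proof -
    have "G ` {a..b} = {G a..G b}"
    proof
      show "{G a..G b} \<subseteq> G ` {a..b}"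
      proof
        fix y assume "y \<in> {G a..G b}"
        then have "H y \<in> {a..b}" using mono GH by (metis atLeastAtMost_iff)
        then show "y \<in> G ` {a..b}" using GH by (metis imageI)
      qed
    qed (auto simp: mono)
    then have I: "(\<integral>\<^sup>+x. f x * indicator {a..b} x \<partial>lborel) = ennreal (G b - G a)"
      using emeasure_density[OF f(1), of "{a..b}"] em[of "{a..b}"] f(2) mono that by simp
    then have "AE x in lborel. f x * indicator {a..b} x \<noteq> \<infinity>"
      using f(1) by (intro nn_integral_PInf_AE) auto
    then have "(\<integral>\<^sup>+x. ennreal (g x * indicator {a..b} x) \<partial>lborel) = (\<integral>\<^sup>+x. f x * indicator {a..b} x \<partial>lborel)"
      by (intro nn_integral_cong_AE) (auto elim!: eventually_mono simp: g_def indicator_def less_top)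
    with I have "((\<lambda>x. g x * indicator {a..b} x) has_integral (G b - G a)) UNIV"
      using gm g0 that mono by (intro nn_integral_has_integral) auto
    then show ?thesis
      by (subst has_integral_restrict_UNIV[symmetric]) (simp add: indicator_def of_bool_def if_distrib cong: if_cong)
  qed
  then show thesis by (rule that)
qed

text \<open>Lebesgue's differentiation theorem on the line. The one-sided averages to the right of a point
converge almost everywhere by \<open>integrable_ccontinuous_explicit\<close>; those to the left are treated by
reflection.\<close>

lemma indefinite_integral_has_derivative_ae:
  fixes g G :: "real \<Rightarrow> real"
  assumes G: "\<And>a b. a \<le> b \<Longrightarrow> (g has_integral (G b - G a)) {a..b}"
  obtains N where "negligible N" "\<And>x. x \<notin> N \<Longrightarrow> (G has_real_derivative g x) (at x)"
proof -
  have int: "g integrable_on cbox a b" for a b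
    using G[of a b] by (cases "a \<le> b") (auto simp: integrable_on_def)
  have G': "((\<lambda>x. g (- x)) has_integral (G (- a) - G (- b))) {a..b}" if "a \<le> b" for a b
    using has_integral_reflect_real[of g "G (- a) - G (- b)" "-a" "-b"] G[of "-b" "-a"] that by simp
  then have int': "(\<lambda>x. g (- x)) integrable_on cbox a b" for a b
    using G'[of a b] by (cases "a \<le> b") (auto simp: integrable_on_def)
  obtain N1 where N1: "negligible N1" and R: "\<And>x e. \<lbrakk>x \<notin> N1; 0 < e\<rbrakk> \<Longrightarrow>
     \<exists>d>0. \<forall>h. 0 < h \<and> h < d \<longrightarrow> norm (integral (cbox x (x + h *\<^sub>R One)) g /\<^sub>R h ^ DIM(real) - g x) < e"
    using integrable_ccontinuous_explicit[OF int] by metis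
  obtain N2 where N2: "negligible N2" and L: "\<And>x e. \<lbrakk>x \<notin> N2; 0 < e\<rbrakk> \<Longrightarrow>
     \<exists>d>0. \<forall>h. 0 < h \<and> h < d \<longrightarrow> norm (integral (cbox x (x + h *\<^sub>R One)) (\<lambda>x. g (- x)) /\<^sub>R h ^ DIM(real) - g (- x)) < e"
    using integrable_ccontinuous_explicit[OF int'] by metis
  have "negligible (uminus ` N2)"
  proof (rule negligible_locally_Lipschitz_image[OF order_refl N2])
    fix x assume "x \<in> N2"
    show "\<exists>T B. open T \<and> x \<in> T \<and> (\<forall>y\<in>N2 \<inter> T. norm (- y - - x) \<le> B * norm (y - x))"
      by (intro exI[of _ UNIV] exI[of _ 1]) (auto simp: abs_minus_commute)
  qed
  then have "negligible (N1 \<union> uminus ` N2)" using N1 by (rule negligible_Un[rotated])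
  moreover have "(G has_real_derivative g x) (at x)" if x: "x \<notin> N1 \<union> uminus ` N2" for x
    unfolding DERIV_def LIM_eq
  proof (intro allI impI)
    fix e :: real assume e: "0 < e"
    have "- x \<notin> N2" using x by (metis UnCI add.inverse_inverse imageI)
    then obtain d1 d2 where d: "d1 > 0" "d2 > 0"
      and r: "\<And>h. 0 < h \<Longrightarrow> h < d1 \<Longrightarrow> \<bar>integral {x..x + h} g / h - g x\<bar> < e"
      and l: "\<And>h. 0 < h \<Longrightarrow> h < d2 \<Longrightarrow> \<bar>integral {- x..- x + h} (\<lambda>x. g (- x)) / h - g x\<bar> < e"
      using R[OF _ e, of x] L[OF _ e, of "-x"] x by (auto simp: divide_inverse mult.commute)
    have "norm ((G (x + h) - G x) / h - g x) < e" if h: "h \<noteq> 0" "norm h < min d1 d2" for h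
    proof (cases "h > 0")
      case True
      then have "integral {x..x + h} g = G (x + h) - G x"
        using G[of x "x + h"] by (intro integral_unique) simp
      then show ?thesis using r[of h] True h by simp
    next
      case False
      then have "integral {- x..- x - h} (\<lambda>x. g (- x)) = G x - G (x + h)"
        using G'[of "-x" "- x - h"] h by (intro integral_unique) (simp add: add.commute)
      moreover have "(G x - G (x + h)) / (- h) = (G (x + h) - G x) / h"
        using h by (simp add: field_simps)
      ultimately show ?thesis using l[of "- h"] False h by simp
    qed
    then show "\<exists>s>0. \<forall>h. h \<noteq> 0 \<and> norm (h - 0) < s \<longrightarrow> norm ((G (x + h) - G x) / h - g x) < e"
      using d by (intro exI[of _ "min d1 d2"]) auto
  qed
  ultimately show thesis using that by blast
qed

text \<open>The function \<open>F\<close>, extended by constants and increased by \<open>(L + 1) t\<close>, is bi-Lipschitz on the whole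
line, hence an indefinite integral.\<close>

lemma lipschitz_derivative_ae:
  fixes F :: "real \<Rightarrow> real"
  assumes "L-lipschitz_on {a..b} F"
  obtains N f where "negligible N" "\<And>t. t \<in> {a<..<b} - N \<Longrightarrow> (F has_real_derivative f t) (at t)"
    "a \<le> b \<Longrightarrow> (f has_integral (F b - F a)) {a..b}"
proof (cases "a \<le> b")
  case False
  then show thesis using that[of "{}"] by simp
next
  case ab: True
  \<comment> \<open>The slopes of \<open>G\<close> lie between \<open>1\<close> and \<open>2 L + 1\<close>.\<close>
  define cl where "cl t = max a (min b t)" for t
  define G where "G t = F (cl t) + (L + 1) * t" for t
  have L: "0 \<le> L" using assms lipschitz_on_nonneg by blast
  have FL: "\<bar>F (cl t) - F (cl s)\<bar> \<le> L * (t - s)" if "s \<le> t" for s t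
  proof -
    have "\<bar>F (cl t) - F (cl s)\<bar> \<le> L * \<bar>cl t - cl s\<bar>"
      using lipschitz_onD[OF assms, of "cl t" "cl s"] ab by (auto simp: dist_real_def cl_def)
    also have "\<dots> \<le> L * (t - s)"
      using that L by (intro mult_left_mono) (auto simp: cl_def)
    finally show ?thesis .
  qed
  have "t - s \<le> G t - G s" "G t - G s \<le> (2 * L + 1) * (t - s)" if "s \<le> t" for s t
    using FL[OF that] by (auto simp: G_def algebra_simps abs_le_iff)
  then obtain g where g: "\<And>a b. a \<le> b \<Longrightarrow> (g has_integral (G b - G a)) {a..b}"
    using bilipschitz_is_indefinite_integral[of G "2 * L + 1"] by blast
  obtain N where N: "negligible N" "\<And>x. x \<notin> N \<Longrightarrow> (G has_real_derivative g x) (at x)"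
    using indefinite_integral_has_derivative_ae[OF g] by blast
  show thesis
  proof (rule that[OF N(1), of "\<lambda>t. g t - (L + 1)"])
    fix t assume t: "t \<in> {a<..<b} - N"
    have "((\<lambda>t. G t - (L + 1) * t) has_real_derivative g t - (L + 1)) (at t)"
      using t by (auto intro!: derivative_eq_intros N(2))
    then show "(F has_real_derivative g t - (L + 1)) (at t)"
      by (rule has_field_derivative_transform_within_open[where S="{a<..<b}"])
        (use t in \<open>auto simp: G_def cl_def\<close>)
  next
    have "((\<lambda>t. g t - (L + 1)) has_integral (G b - G a - (L + 1) * (b - a))) {a..b}"
      using has_integral_diff[OF g[OF ab] has_integral_const_real[of "L + 1" a b]] ab by (simp add: mult.commute)
    then show "((\<lambda>t. g t - (L + 1)) has_integral (F b - F a)) {a..b}"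
      using ab by (simp add: G_def cl_def algebra_simps)
  qed
qed

lemma lipschitz_differentiable_ae:
  fixes F :: "real \<Rightarrow> 'b::euclidean_space"
  assumes "L-lipschitz_on {a..b} F"
  obtains N where "negligible N" "\<And>t. t \<in> {a<..<b} - N \<Longrightarrow> F differentiable (at t)"
proof -
  have "\<exists>N. negligible N \<and> (\<forall>t\<in>{a<..<b} - N. (\<lambda>t. F t \<bullet> i) differentiable (at t))" if "i \<in> Basis" for i
  proof -
    have "L-lipschitz_on {a..b} (\<lambda>t. F t \<bullet> i)"
    proof (rule lipschitz_onI)
      fix s t assume st: "s \<in> {a..b}" "t \<in> {a..b}"
      have "\<bar>(F s - F t) \<bullet> i\<bar> \<le> norm (F s - F t)"
        using that by (rule Basis_le_norm)
      then show "dist (F s \<bullet> i) (F t \<bullet> i) \<le> L * dist s t"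
        using lipschitz_onD[OF assms st] by (simp add: dist_norm inner_diff_left)
    qed (use assms lipschitz_on_nonneg in blast)
    then obtain N f where "negligible N" "\<And>t. t \<in> {a<..<b} - N \<Longrightarrow> ((\<lambda>t. F t \<bullet> i) has_real_derivative f t) (at t)"
      using lipschitz_derivative_ae by metis
    then show ?thesis
      by (metis field_differentiable_def field_differentiable_imp_differentiable)
  qed
  then obtain N where N: "\<And>i. i \<in> Basis \<Longrightarrow> negligible (N i)"
    "\<And>i t. i \<in> Basis \<Longrightarrow> t \<in> {a<..<b} - N i \<Longrightarrow> (\<lambda>t. F t \<bullet> i) differentiable (at t)"
    by metis
  show thesis
  proof (rule that[of "\<Union>i\<in>Basis. N i"])
    show "negligible (\<Union>i\<in>Basis. N i)" using N by (intro negligible_Union) auto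
    show "F differentiable (at t)" if "t \<in> {a<..<b} - (\<Union>i\<in>Basis. N i)" for t
      using N(2) that by (subst differentiable_componentwise_within) auto
  qed
qed

text \<open>The fundamental theorem of calculus for Lipschitz functions, with an arbitrary negligible set of
exceptional times.\<close>

lemma lipschitz_has_integral_derivative:
  fixes F :: "real \<Rightarrow> real"
  assumes "L-lipschitz_on {a..b} F" "a \<le> b" "negligible N"
    and "\<And>t. t \<in> {a<..<b} - N \<Longrightarrow> (F has_real_derivative f t) (at t)"
  shows "(f has_integral (F b - F a)) {a..b}"
proof -
  obtain N' g where N': "negligible N'" "\<And>t. t \<in> {a<..<b} - N' \<Longrightarrow> (F has_real_derivative g t) (at t)"
    and g: "(g has_integral (F b - F a)) {a..b}"
    using lipschitz_derivative_ae[OF assms(1)] assms(2) by metis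
  show ?thesis
  proof (rule has_integral_spike[OF _ _ g])
    show "negligible (N \<union> N' \<union> {a, b})" using assms(3) N'(1) by simp
    show "f t = g t" if "t \<in> {a..b} - (N \<union> N' \<union> {a, b})" for t
      using DERIV_unique[OF assms(4)[of t] N'(2)[of t]] that by auto
  qed
qed


section \<open>Charts and transition maps\<close>

lemma chart_inv_left: "inj_on (snd c) (fst c) \<Longrightarrow> x \<in> fst c \<Longrightarrow> chart_inv c (snd c x) = x"
  by (simp add: chart_inv_def)

lemma transition_apply:
  "inj_on (snd c) (fst c) \<Longrightarrow> x \<in> fst c \<Longrightarrow> transition c c' (snd c x) = snd c' x"
  by (simp add: transition_def chart_inv_left)

lemma transition_has_derivative:
  assumes "smooth_compatible c c'" "x \<in> fst c" "x \<in> fst c'"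
  shows "(transition c c' has_derivative frechet_derivative (transition c c') (at (snd c x))) (at (snd c x))"
  using assms unfolding smooth_compatible_def
  by (intro smooth_on_has_derivative[of "snd c ` (fst c \<inter> fst c')"]) auto

lemma eventually_in_overlap:
  assumes "smooth_compatible c c'" "x \<in> fst c" "x \<in> fst c'"
  shows "\<forall>\<^sub>F y in nhds (snd c x). y \<in> snd c ` (fst c \<inter> fst c')"
  using assms unfolding smooth_compatible_def eventually_nhds by blast

lemma transition_derivative_cocycle:
  assumes "smooth_compatible c c'" "smooth_compatible c' c''" "smooth_compatible c c''"
    and inj: "inj_on (snd c) (fst c)" "inj_on (snd c') (fst c')"
    and x: "x \<in> fst c" "x \<in> fst c'" "x \<in> fst c''"
  shows "frechet_derivative (transition c' c'') (at (snd c' x))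
      (frechet_derivative (transition c c') (at (snd c x)) v)
    = frechet_derivative (transition c c'') (at (snd c x)) v"
proof -
  have "((\<lambda>y. transition c' c'' (transition c c' y)) has_derivative
     (\<lambda>v. frechet_derivative (transition c' c'') (at (snd c' x))
      (frechet_derivative (transition c c') (at (snd c x)) v))) (at (snd c x))"
    using has_derivative_compose[OF transition_has_derivative[OF assms(1) x(1,2)]]
      transition_has_derivative[OF assms(2) x(2,3)] transition_apply[OF inj(1) x(1)] by metis
  then have "(transition c c'' has_derivative
     (\<lambda>v. frechet_derivative (transition c' c'') (at (snd c' x))
      (frechet_derivative (transition c c') (at (snd c x)) v))) (at (snd c x))"
  proof (rule has_derivative_transform_within_open)
    show "open (snd c ` (fst c \<inter> fst c'))" using assms(1) by (simp add: smooth_compatible_def)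
  qed (use x in \<open>auto simp: transition_apply inj\<close>)
  from fun_cong[OF frechet_derivative_at[OF this]] show ?thesis by simp
qed

text \<open>This provides the chart of the cotangent bundle in which the pseudograph becomes a graph: a
canonical chart followed by a linear change of coordinates.\<close>

lemma smooth_compatible_linear:
  fixes c c' :: "('a, 'e::euclidean_space) chart"
  assumes cc: "smooth_compatible c c'" and inj: "inj_on (snd c) (fst c)"
    and L: "bounded_linear L" and L': "bounded_linear L'"
    and inv: "\<And>y. L' (L y) = y" "\<And>y. L (L' y) = y"
  shows "smooth_compatible (fst c, L \<circ> snd c) c'"
proof -
  let ?d = "(fst c, L \<circ> snd c)"
  let ?S = "snd c ` (fst c \<inter> fst c')" and ?S' = "snd c' ` (fst c \<inter> fst c')"
  have S: "open ?S" "open ?S'" "smooth_on ?S (transition c c')" "smooth_on ?S' (transition c' c)"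
    using cc by (auto simp: smooth_compatible_def Int_commute)
  have LS: "L ` T = L' -` T" for T using inv by (auto simp: image_iff) metis
  have "open (L ` ?S)"
    unfolding LS using S(1) L' by (intro open_vimage linear_continuous_on)
  have eq: "transition ?d c' y = transition c c' (L' y)" if y: "y \<in> L ` ?S" for y
  proof -
    obtain x where x: "x \<in> fst c" "y = L (snd c x)" using y by auto
    have "inj_on (snd ?d) (fst ?d)"
      using inj inv(1) by (auto simp: inj_on_def) metis
    then have "transition ?d c' y = snd c' x"
      using transition_apply[of ?d x c'] x by simp
    then show ?thesis using transition_apply[OF inj x(1)] x(2) inv(1) by simp
  qed
  have "smooth_on (L ` ?S) (\<lambda>y. transition c c' (L' y))"
    by (rule smooth_on_compose[OF \<open>open (L ` ?S)\<close> S(1) _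
          smooth_on_bounded_linear[OF L' \<open>open (L ` ?S)\<close>] S(3)]) (auto simp: inv(1))
  then have 1: "smooth_on (L ` ?S) (transition ?d c')"
    using smooth_on_cong[OF \<open>open (L ` ?S)\<close> eq] by simp
  have "smooth_on ?S' (\<lambda>y. L (transition c' c y))"
    by (rule smooth_on_compose[OF S(2) open_UNIV _ S(4) smooth_on_bounded_linear[OF L open_UNIV]]) simp
  then have 2: "smooth_on ?S' (transition c' ?d)"
    by (simp add: transition_def o_def)
  show ?thesis
    using \<open>open (L ` ?S)\<close> S(2) 1 2 by (simp add: smooth_compatible_def Int_commute image_comp)
qed


lemma linear_functional_eq_inner:
  fixes p :: "'e::euclidean_space \<Rightarrow> real"
  assumes "linear p" obtains q where "p = (\<lambda>h. q \<bullet> h)"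
proof
  show "p = (\<lambda>h. adjoint p 1 \<bullet> h)"
    using adjoint_works[OF assms, of _ 1] by (auto simp: inner_commute)
qed

text \<open>The formula displays that the adjoint depends smoothly on a parameter as soon as the images of the
basis vectors do.\<close>

lemma adjoint_eq_sum:
  fixes L :: "'e::euclidean_space \<Rightarrow> 'e"
  assumes "linear L" shows "adjoint L q = (\<Sum>b\<in>Basis. (q \<bullet> L b) *\<^sub>R b)"
proof -
  have "adjoint L q \<bullet> b = q \<bullet> L b" for b
    using adjoint_works[OF assms, of b q] by (simp add: inner_commute)
  then show ?thesis using euclidean_representation[of "adjoint L q"] by simp
qed


section \<open>Tangent and cotangent spaces\<close>

locale smooth_atlas =
  fixes X :: "'a topology" and A :: "('a, 'e::euclidean_space) chart set"
  assumes mfd: "smooth_manifold X A"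
begin

lemma compatible: "c \<in> A \<Longrightarrow> c' \<in> A \<Longrightarrow> smooth_compatible c c'"
  using mfd by (simp add: smooth_manifold_def)

lemma chart_inj:
  assumes "c \<in> A" shows "inj_on (snd c) (fst c)"
proof -
  have "openin X (fst c)" "homeomorphic_map (subtopology X (fst c)) (top_of_set (snd c ` fst c)) (snd c)"
    using mfd assms by (auto simp: smooth_manifold_def)
  then show ?thesis
    using homeomorphic_imp_injective_map topspace_subtopology_subset openin_subset by metis
qed

lemma chart_open: "c \<in> A \<Longrightarrow> open (snd c ` fst c)"
  using mfd by (simp add: smooth_manifold_def)

lemma charts_atD: "c \<in> charts_at A x \<Longrightarrow> c \<in> A" "c \<in> charts_at A x \<Longrightarrow> x \<in> fst c"
  by (auto simp: charts_at_def)

abbreviation D :: "('a, 'e) chart \<Rightarrow> ('a, 'e) chart \<Rightarrow> 'a \<Rightarrow> 'e \<Rightarrow> 'e" where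
  "D c c' x \<equiv> frechet_derivative (transition c c') (at (snd c x))"

lemma D_has_derivative:
  "c \<in> charts_at A x \<Longrightarrow> c' \<in> charts_at A x \<Longrightarrow> (transition c c' has_derivative D c c' x) (at (snd c x))"
  by (auto simp: charts_at_def intro!: transition_has_derivative compatible)

lemma D_linear: "c \<in> charts_at A x \<Longrightarrow> c' \<in> charts_at A x \<Longrightarrow> linear (D c c' x)"
  using D_has_derivative has_derivative_linear by blast

lemma D_cocycle:
  "c \<in> charts_at A x \<Longrightarrow> c' \<in> charts_at A x \<Longrightarrow> c'' \<in> charts_at A x \<Longrightarrow>
   D c' c'' x (D c c' x v) = D c c'' x v"
  by (auto simp: charts_at_def intro!: transition_derivative_cocycle compatible chart_inj)

lemma D_refl:
  assumes "c \<in> charts_at A x" shows "D c c x = (\<lambda>v. v)"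
proof -
  have "((\<lambda>y. y) has_derivative (\<lambda>v. v)) (at (snd c x))" by (rule has_derivative_ident)
  then have "(transition c c has_derivative (\<lambda>v. v)) (at (snd c x))"
  proof (rule has_derivative_transform_within_open)
    show "open (snd c ` fst c)" using chart_open assms by (simp add: charts_at_def)
  qed (use assms in \<open>auto simp: charts_at_def transition_apply chart_inj\<close>)
  then show ?thesis using frechet_derivative_at by metis
qed

lemma tangentD:
  "v \<in> tangent_space A x \<Longrightarrow> c \<in> charts_at A x \<Longrightarrow> c' \<in> charts_at A x \<Longrightarrow> v c' = D c c' x (v c)"
  unfolding tangent_space_def by blast

lemma tangent_zero: "v \<in> tangent_space A x \<Longrightarrow> c \<notin> charts_at A x \<Longrightarrow> v c = 0"
  unfolding tangent_space_def by blast

lemma tangentI: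
  assumes "\<And>c. c \<notin> charts_at A x \<Longrightarrow> v c = 0"
    and "\<And>c c'. c \<in> charts_at A x \<Longrightarrow> c' \<in> charts_at A x \<Longrightarrow> v c' = D c c' x (v c)"
  shows "v \<in> tangent_space A x"
  unfolding tangent_space_def using assms by blast

text \<open>The inverse of the evaluation \<open>v \<mapsto> v c\<close>, which identifies the tangent space with the model space.\<close>

definition tangent_of :: "('a, 'e) chart \<Rightarrow> 'a \<Rightarrow> 'e \<Rightarrow> ('a, 'e) tangent" where
  "tangent_of c x h = (\<lambda>c'. if c' \<in> charts_at A x then D c c' x h else 0)"

lemma tangent_of_in: "c \<in> charts_at A x \<Longrightarrow> tangent_of c x h \<in> tangent_space A x"
  by (rule tangentI) (auto simp: tangent_of_def D_cocycle)

lemma tangent_of_same: "c \<in> charts_at A x \<Longrightarrow> tangent_of c x h c = h"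
  by (simp add: tangent_of_def D_refl)

lemma tangent_of_coord:
  assumes "v \<in> tangent_space A x" "c \<in> charts_at A x"
  shows "tangent_of c x (v c) = v"
proof
  show "tangent_of c x (v c) c' = v c'" for c'
    unfolding tangent_of_def using tangentD[OF assms, of c'] tangent_zero[OF assms(1), of c'] by presburger
qed

lemma tangent_space_add:
  assumes "v \<in> tangent_space A x" "w \<in> tangent_space A x"
  shows "(\<lambda>c. v c + w c) \<in> tangent_space A x"
proof (rule tangentI)
  fix c c' assume c: "c \<in> charts_at A x" "c' \<in> charts_at A x"
  show "v c' + w c' = D c c' x (v c + w c)"
    using tangentD[OF assms(1) c] tangentD[OF assms(2) c] linear_add[OF D_linear[OF c]] by presburger
qed (simp add: assms[THEN tangent_zero])

lemma tangent_space_scaleR: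
  assumes "v \<in> tangent_space A x"
  shows "(\<lambda>c. r *\<^sub>R v c) \<in> tangent_space A x"
proof (rule tangentI)
  fix c c' assume c: "c \<in> charts_at A x" "c' \<in> charts_at A x"
  show "r *\<^sub>R v c' = D c c' x (r *\<^sub>R v c)"
    using tangentD[OF assms(1) c] linear_scale[OF D_linear[OF c]] by presburger
qed (simp add: assms[THEN tangent_zero])

lemma tangent_of_add:
  "c \<in> charts_at A x \<Longrightarrow> tangent_of c x (h + k) = (\<lambda>c'. tangent_of c x h c' + tangent_of c x k c')"
  by (simp add: tangent_of_def fun_eq_iff linear_add[OF D_linear])

lemma tangent_of_scaleR:
  "c \<in> charts_at A x \<Longrightarrow> tangent_of c x (r *\<^sub>R h) = (\<lambda>c'. r *\<^sub>R tangent_of c x h c')"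
  by (simp add: tangent_of_def fun_eq_iff linear_scale[OF D_linear])

text \<open>The covector \<open>\<Sum> q\<^sub>i dx\<^sub>i\<close> in the coordinates \<open>x\<^sub>i\<close> of \<open>c\<close>; all covectors are of this form, see
\<open>cotangent_space_eq\<close>.\<close>

definition covector_of :: "('a, 'e) chart \<Rightarrow> 'a \<Rightarrow> 'e \<Rightarrow> ('a, 'e) tangent \<Rightarrow> real" where
  "covector_of c x q = restrict (\<lambda>v. q \<bullet> v c) (tangent_space A x)"

lemma covector_of_apply: "v \<in> tangent_space A x \<Longrightarrow> covector_of c x q v = q \<bullet> v c"
  by (simp add: covector_of_def)

lemma covector_of_in: "covector_of c x q \<in> cotangent_space A x"
  by (auto simp: cotangent_space_def covector_of_def tangent_space_add tangent_space_scaleR inner_simps)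

lemma covector_of_inject:
  assumes "c \<in> charts_at A x" "covector_of c x q = covector_of c x q'" shows "q = q'"
proof (rule vector_eq_rdot[THEN iffD1], rule allI)
  show "q \<bullet> h = q' \<bullet> h" for h
    using fun_cong[OF assms(2), of "tangent_of c x h"]
    by (simp add: covector_of_apply tangent_of_in tangent_of_same assms(1))
qed

lemma cotangent_space_eq:
  assumes c: "c \<in> charts_at A x" and p: "p \<in> cotangent_space A x"
  obtains q where "p = covector_of c x q"
proof -
  have "linear (\<lambda>h. p (tangent_of c x h))"
    using p c unfolding cotangent_space_def
    by (intro linearI) (simp_all add: tangent_of_add tangent_of_scaleR tangent_of_in)
  then obtain q where q: "(\<lambda>h. p (tangent_of c x h)) = (\<lambda>h. q \<bullet> h)"
    using linear_functional_eq_inner by blast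
  have "p = covector_of c x q"
  proof (rule extensionalityI)
    show "p v = covector_of c x q v" if "v \<in> tangent_space A x" for v
      using fun_cong[OF q, of "v c"] that c by (simp add: tangent_of_coord covector_of_apply)
  qed (use p in \<open>auto simp: cotangent_space_def covector_of_def\<close>)
  then show thesis by (rule that)
qed

lemma covector_of_change:
  assumes "c \<in> charts_at A x" "c' \<in> charts_at A x"
  shows "covector_of c x q = covector_of c' x (adjoint (D c' c x) q)"
proof (rule extensionalityI)
  fix v assume v: "v \<in> tangent_space A x"
  have "q \<bullet> v c = adjoint (D c' c x) q \<bullet> v c'"
    using adjoint_works[OF D_linear[OF assms(2,1)]] tangentD[OF v assms(2,1)]
    by (simp add: inner_commute)
  then show "covector_of c x q v = covector_of c' x (adjoint (D c' c x) q) v"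
    using v by (simp add: covector_of_apply)
qed (auto simp: covector_of_def)


section \<open>The charts of the cotangent bundle\<close>

abbreviation T :: "('a, 'e) chart \<Rightarrow> (('a, 'e) covector, 'e \<times> 'e) chart" where
  "T c \<equiv> cotangent_chart A c"

lemma cotangent_chart_domain_iff:
  "c \<in> A \<Longrightarrow> (x, p) \<in> fst (T c) \<longleftrightarrow> x \<in> fst c \<and> p \<in> cotangent_space A x"
  by (auto simp: cotangent_chart_def cotangent_bundle_def)

lemma cotangent_chart_domainE:
  assumes "c \<in> A" "z \<in> fst (T c)"
  obtains x q where "x \<in> fst c" "z = (x, covector_of c x q)"
proof -
  obtain x p where z: "z = (x, p)" by (rule prod.exhaust)
  have "x \<in> fst c" "p \<in> cotangent_space A x"
    using assms(2) unfolding z cotangent_chart_domain_iff[OF assms(1)] by blast+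
  moreover from this obtain q where "p = covector_of c x q"
    using cotangent_space_eq[of c x p] assms(1) by (auto simp: charts_at_def)
  ultimately show thesis using that z by blast
qed

lemma covector_of_in_domain: "c \<in> A \<Longrightarrow> x \<in> fst c \<Longrightarrow> (x, covector_of c' x q) \<in> fst (T c)"
  by (simp add: cotangent_chart_domain_iff covector_of_in)

lemma cotangent_chart_apply:
  assumes "c \<in> charts_at A x"
  shows "snd (T c) (x, covector_of c x q) = (snd c x, q)"
proof -
  have "(THE q'. \<forall>v\<in>tangent_space A x. covector_of c x q v = q' \<bullet> v c) = q"
  proof (rule the_equality)
    fix q' assume "\<forall>v\<in>tangent_space A x. covector_of c x q v = q' \<bullet> v c"
    then have "covector_of c x q = covector_of c x q'"
      by (auto simp: covector_of_def restrict_def)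
    then show "q' = q" using covector_of_inject[OF assms] by metis
  qed (simp add: covector_of_apply)
  then show ?thesis by (simp add: cotangent_chart_def)
qed

lemma cotangent_chart_apply': "c \<in> A \<Longrightarrow> x \<in> fst c \<Longrightarrow> snd (T c) (x, covector_of c x q) = (snd c x, q)"
  by (simp add: cotangent_chart_apply charts_at_def)

lemma cotangent_chart_inj:
  assumes "c \<in> A" shows "inj_on (snd (T c)) (fst (T c))"
proof (rule inj_onI)
  fix z w assume "z \<in> fst (T c)" "w \<in> fst (T c)" and eq: "snd (T c) z = snd (T c) w"
  then obtain x q y r where x: "x \<in> fst c" "z = (x, covector_of c x q)"
    and y: "y \<in> fst c" "w = (y, covector_of c y r)"
    using cotangent_chart_domainE[OF assms] by metis
  have "snd c x = snd c y" "q = r"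
    using eq x y by (simp_all add: cotangent_chart_apply' assms)
  then show "z = w" using inj_onD[OF chart_inj[OF assms] _ x(1) y(1)] x y by simp
qed

lemma cotangent_chart_overlap:
  assumes "c \<in> A" "c' \<in> A"
  shows "snd (T c) ` (fst (T c) \<inter> fst (T c')) = snd c ` (fst c \<inter> fst c') \<times> UNIV"
proof (intro set_eqI iffI)
  fix w assume "w \<in> snd (T c) ` (fst (T c) \<inter> fst (T c'))"
  then obtain z where z: "z \<in> fst (T c)" "z \<in> fst (T c')" "w = snd (T c) z" by blast
  obtain x q where x: "x \<in> fst c" "z = (x, covector_of c x q)"
    using cotangent_chart_domainE[OF assms(1) z(1)] by blast
  have "x \<in> fst c'" using z(2) unfolding x(2) cotangent_chart_domain_iff[OF assms(2)] by blast
  then show "w \<in> snd c ` (fst c \<inter> fst c') \<times> UNIV"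
    using x(1) unfolding z(3) x(2) cotangent_chart_apply'[OF assms(1) x(1)] by blast
next
  fix w assume "w \<in> snd c ` (fst c \<inter> fst c') \<times> (UNIV :: 'e set)"
  then obtain x q where x: "x \<in> fst c" "x \<in> fst c'" "w = (snd c x, q)" by blast
  then have "w = snd (T c) (x, covector_of c x q)"
    by (simp add: cotangent_chart_apply' assms)
  then show "w \<in> snd (T c) ` (fst (T c) \<inter> fst (T c'))"
    using covector_of_in_domain assms x by blast
qed

lemma cotangent_chart_image:
  assumes "c \<in> A" shows "snd (T c) ` fst (T c) = snd c ` fst c \<times> UNIV"
  using cotangent_chart_overlap[OF assms assms] by simp

lemma cotangent_transition:
  assumes "c \<in> A" "c' \<in> A" "y \<in> snd c ` (fst c \<inter> fst c')"
  shows "transition (T c) (T c') (y, q) =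
    (transition c c' y, adjoint (frechet_derivative (transition c' c) (at (transition c c' y))) q)"
proof -
  obtain x where x: "x \<in> fst c" "x \<in> fst c'" "y = snd c x" using assms(3) by blast
  have at: "c \<in> charts_at A x" "c' \<in> charts_at A x" using x assms by (auto simp: charts_at_def)
  from transition_apply[OF cotangent_chart_inj[OF assms(1)] covector_of_in_domain[OF assms(1) x(1)], of "T c'" c q]
  have "transition (T c) (T c') (y, q) = snd (T c') (x, covector_of c x q)"
    using at x by (simp add: cotangent_chart_apply)
  also have "\<dots> = (snd c' x, adjoint (D c' c x) q)"
    using covector_of_change[OF at] cotangent_chart_apply[OF at(2)] by simp
  finally show ?thesis
    using transition_apply[OF chart_inj[OF assms(1)] x(1)] x(3) by simp
qed

text \<open>The coordinates \<open>q\<close> are transformed by the transpose of the derivative of the inverse transition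
map, which is a smooth function of the base point.\<close>

lemma cotangent_transition_smooth:
  assumes "c \<in> A" "c' \<in> A"
  shows "smooth_on (snd c ` (fst c \<inter> fst c') \<times> UNIV) (transition (T c) (T c'))"
proof -
  let ?S = "snd c ` (fst c \<inter> fst c')" and ?S' = "snd c' ` (fst c \<inter> fst c')"
  let ?\<phi> = "transition c c'" and ?\<psi> = "transition c' c"
  have S: "open ?S" "open ?S'" "smooth_on ?S ?\<phi>" "smooth_on ?S' ?\<psi>"
    using compatible[OF assms] by (auto simp: smooth_compatible_def Int_commute)
  have im: "?\<phi> ` ?S \<subseteq> ?S'"
    by (auto simp: transition_apply[OF chart_inj[OF assms(1)]])
  have O: "open (?S \<times> (UNIV :: 'e set))" using S by (simp add: open_Times)
  have \<phi>: "smooth_on (?S \<times> (UNIV :: 'e set)) (\<lambda>z. ?\<phi> (fst z))"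
    by (rule smooth_on_compose[OF O S(1) _ smooth_on_bounded_linear[OF bounded_linear_fst O] S(3)]) auto
  have \<psi>: "smooth_on (?S \<times> (UNIV :: 'e set)) (\<lambda>z. frechet_derivative ?\<psi> (at (?\<phi> (fst z))) b)" for b
    by (rule smooth_on_compose[OF O S(2) _ \<phi> smooth_on_frechet_derivative[OF S(4)]]) (use im in auto)
  have snd: "smooth_on (?S \<times> (UNIV :: 'e set)) snd"
    using O by (intro smooth_on_bounded_linear bounded_linear_snd)
  let ?f = "\<lambda>z. (?\<phi> (fst z), \<Sum>b\<in>Basis. (snd z \<bullet> frechet_derivative ?\<psi> (at (?\<phi> (fst z))) b) *\<^sub>R b)"
  have "smooth_on (?S \<times> (UNIV :: 'e set)) ?f"
    by (intro smooth_on_Pair smooth_on_sum smooth_on_scaleR smooth_on_inner smooth_on_const O \<phi> \<psi> snd) simp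
  moreover have "?f z = transition (T c) (T c') z" if z: "z \<in> ?S \<times> UNIV" for z
  proof -
    obtain x where x: "x \<in> fst c" "x \<in> fst c'" "fst z = snd c x" using z by auto
    have "linear (frechet_derivative ?\<psi> (at (?\<phi> (fst z))))"
      using D_linear[of c' x c] x assms transition_apply[OF chart_inj[OF assms(1)] x(1)]
      by (simp add: charts_at_def)
    from adjoint_eq_sum[OF this, of "snd z"] show ?thesis
      using cotangent_transition[OF assms, of "fst z" "snd z"] z by auto
  qed
  ultimately show ?thesis using smooth_on_cong[OF O, of ?f] by blast
qed

lemma cotangent_charts_compatible:
  assumes "c \<in> A" "c' \<in> A" shows "smooth_compatible (T c) (T c')"
proof -
  have "open (snd c ` (fst c \<inter> fst c'))" "open (snd c' ` (fst c' \<inter> fst c))"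
    using compatible[OF assms] by (auto simp: smooth_compatible_def Int_commute)
  then show ?thesis
    using cotangent_chart_overlap[of c c'] cotangent_chart_overlap[of c' c] assms
      cotangent_transition_smooth[of c c'] cotangent_transition_smooth[of c' c]
    by (simp add: smooth_compatible_def Int_commute open_Times)
qed

end


section \<open>The pseudograph is a Lipschitz submanifold\<close>

context smooth_atlas
begin

text \<open>By definition a point of the pseudograph is given by a super-differential in \<^emph>\<open>some\<close> chart. Passing
to Frechet super-differentials, transporting these to the chart \<open>c\<close> and going back shows that its
coordinates are a super-differential in any chart around the base point.\<close>

lemma pseudograph_in_chart:
  assumes sc: "semiconcave A K u" and c: "c \<in> charts_at A x"
  shows "(x, p) \<in> enlarged_pseudograph A K u \<longleftrightarrow>
    (\<exists>q. p = covector_of c x q \<and>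
      (\<lambda>h. q \<bullet> h) \<in> superdifferential K (snd c ` fst c) (u \<circ> chart_inv c) (snd c x))"
    (is "?L \<longleftrightarrow> ?R")
proof
  assume ?R
  then obtain q where q: "p = covector_of c x q"
    "(\<lambda>h. q \<bullet> h) \<in> superdifferential K (snd c ` fst c) (u \<circ> chart_inv c) (snd c x)" by blast
  have "p = restrict (\<lambda>v. (\<lambda>h. q \<bullet> h) (v c)) (tangent_space A x)"
    using q(1) by (simp add: covector_of_def)
  then show ?L
    unfolding enlarged_pseudograph_def using c q(2) by blast
next
  assume ?L
  then obtain c0 P where c0: "c0 \<in> charts_at A x" and p: "p = restrict (\<lambda>v. P (v c0)) (tangent_space A x)"
    and P: "P \<in> superdifferential K (snd c0 ` fst c0) (u \<circ> chart_inv c0) (snd c0 x)"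
    unfolding enlarged_pseudograph_def by blast
  note cA = charts_atD[OF c] and c0A = charts_atD[OF c0]
  have comp: "smooth_compatible c c0" using compatible cA(1) c0A(1) .
  have x: "transition c c0 (snd c x) = snd c0 x"
    using transition_apply[OF chart_inj[OF cA(1)] cA(2)] .
  have "frechet_super (u \<circ> chart_inv c0) (transition c c0 (snd c x)) P"
    unfolding x using chart_open[OF c0A(1)] c0A(2) P by (intro superdifferential_imp_frechet_super) auto
  then have "frechet_super (\<lambda>y. (u \<circ> chart_inv c0) (transition c c0 y)) (snd c x) (\<lambda>h. P (D c c0 x h))"
    by (rule frechet_super_compose[OF _ D_has_derivative[OF c c0]])
  moreover have "\<forall>\<^sub>F y in nhds (snd c x). (u \<circ> chart_inv c0) (transition c c0 y) = (u \<circ> chart_inv c) y"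
    using eventually_in_overlap[OF comp cA(2) c0A(2)]
  proof eventually_elim
    case (elim y)
    then obtain z where "z \<in> fst c" "z \<in> fst c0" "y = snd c z" by blast
    then show ?case
      by (simp add: transition_apply chart_inj[OF cA(1)] chart_inj[OF c0A(1)] chart_inv_left)
  qed
  ultimately have fs: "frechet_super (u \<circ> chart_inv c) (snd c x) (\<lambda>h. P (D c c0 x h))"
    by (rule frechet_super_cong)
  then obtain q where q: "(\<lambda>h. P (D c c0 x h)) = (\<lambda>h. q \<bullet> h)"
    unfolding frechet_super_def using linear_functional_eq_inner by blast
  have sem: "semiconcave_on K (snd c ` fst c) (u \<circ> chart_inv c)"
    using sc cA(1) by (simp add: semiconcave_def)
  have "(\<lambda>h. q \<bullet> h) \<in> superdifferential K (snd c ` fst c) (u \<circ> chart_inv c) (snd c x)"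
    using frechet_super_imp_superdifferential[OF chart_open[OF cA(1)] _ sem fs] cA(2) q by simp
  moreover have "p = covector_of c x q"
  proof (rule extensionalityI)
    fix v assume v: "v \<in> tangent_space A x"
    show "p v = covector_of c x q v"
      using fun_cong[OF q, of "v c"] tangentD[OF v c c0] v by (simp add: p covector_of_apply)
  qed (auto simp: p covector_of_def)
  ultimately show ?R by blast
qed

lemma pseudograph_subset: "enlarged_pseudograph A K u \<subseteq> cotangent_bundle A" if "semiconcave A K u"
proof
  fix z assume z: "z \<in> enlarged_pseudograph A K u"
  then obtain x p c where "z = (x, p)" "c \<in> charts_at A x"
    unfolding enlarged_pseudograph_def by blast
  with z pseudograph_in_chart[OF that, of c x p] show "z \<in> cotangent_bundle A"
    by (auto simp: cotangent_bundle_def charts_at_def covector_of_in)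
qed

lemma pseudographE:
  assumes "semiconcave A K u" "z \<in> enlarged_pseudograph A K u"
  obtains c where "c \<in> charts_at A (fst z)"
  using assms(2) unfolding enlarged_pseudograph_def by auto

lemma pseudograph_coords:
  assumes sc: "semiconcave A K u" and c: "c \<in> A" and z: "z \<in> enlarged_pseudograph A K u" "z \<in> fst (T c)"
  shows "fst (snd (T c) z) = snd c (fst z)" "fst (snd (T c) z) \<in> snd c ` fst c"
    "z = (fst z, covector_of c (fst z) (snd (snd (T c) z)))"
    "(\<lambda>h. snd (snd (T c) z) \<bullet> h) \<in> superdifferential K (snd c ` fst c) (u \<circ> chart_inv c) (fst (snd (T c) z))"
proof -
  obtain x p where zx: "z = (x, p)" by (rule prod.exhaust)
  have x: "x \<in> fst c" using z(2) unfolding zx cotangent_chart_domain_iff[OF c] by blast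
  then have cx: "c \<in> charts_at A x" using c by (simp add: charts_at_def)
  obtain q where q: "p = covector_of c x q"
    "(\<lambda>h. q \<bullet> h) \<in> superdifferential K (snd c ` fst c) (u \<circ> chart_inv c) (snd c x)"
    using pseudograph_in_chart[OF sc cx] z(1) zx by blast
  have "snd (T c) z = (snd c x, q)" using zx q(1) cotangent_chart_apply[OF cx] by simp
  then show "fst (snd (T c) z) = snd c (fst z)" "fst (snd (T c) z) \<in> snd c ` fst c"
    "z = (fst z, covector_of c (fst z) (snd (snd (T c) z)))"
    "(\<lambda>h. snd (snd (T c) z) \<bullet> h) \<in> superdifferential K (snd c ` fst c) (u \<circ> chart_inv c) (fst (snd (T c) z))"
    using x zx q by auto
qed

lemma pseudograph_image:
  assumes sc: "semiconcave A K u" and c: "c \<in> A"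
  shows "snd (T c) ` (enlarged_pseudograph A K u \<inter> fst (T c)) =
    {(y, q). y \<in> snd c ` fst c \<and> (\<lambda>h. q \<bullet> h) \<in> superdifferential K (snd c ` fst c) (u \<circ> chart_inv c) y}"
    (is "?I = ?G")
proof
  show "?I \<subseteq> ?G"
  proof (rule image_subsetI)
    fix z assume "z \<in> enlarged_pseudograph A K u \<inter> fst (T c)"
    then show "snd (T c) z \<in> ?G"
      unfolding mem_Collect_eq case_prod_beta using pseudograph_coords(2,4)[OF sc c, of z] by blast
  qed
  show "?G \<subseteq> ?I"
  proof clarify
    fix x q assume x: "x \<in> fst c"
      and q: "(\<lambda>h. q \<bullet> h) \<in> superdifferential K (snd c ` fst c) (u \<circ> chart_inv c) (snd c x)"
    have cx: "c \<in> charts_at A x" using c x by (simp add: charts_at_def)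
    have "(x, covector_of c x q) \<in> enlarged_pseudograph A K u"
      using pseudograph_in_chart[OF sc cx] q by blast
    moreover have "(snd c x, q) = snd (T c) (x, covector_of c x q)"
      using cotangent_chart_apply[OF cx] by simp
    ultimately show "(snd c x, q) \<in> ?I"
      using covector_of_in_domain[OF c x] by blast
  qed
qed

text \<open>The chart is \<open>(y, q) \<mapsto> ((2 K + 1) y - q, y)\<close> after the canonical one. It flattens the whole part of
the pseudograph above the domain of a chart of the manifold: by \<open>minty_lipschitz\<close> the base point
\<open>y\<close> is a function of \<open>(2 K + 1) y - q\<close>.\<close>

lemma lipschitz_submanifold_pseudograph:
  assumes sc: "semiconcave A K u" and "topspace X \<noteq> {}"
  shows "lipschitz_submanifold A (enlarged_pseudograph A K u)"
  unfolding lipschitz_submanifold_def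
proof (intro conjI ballI)
  show "enlarged_pseudograph A K u \<noteq> {}"
  proof -
    have "(\<Union>c\<in>A. fst c) \<noteq> {}" using mfd assms(2) by (simp add: smooth_manifold_def)
    then obtain c x where c: "c \<in> A" "x \<in> fst c" by blast
    then obtain p where "p \<in> superdifferential K (snd c ` fst c) (u \<circ> chart_inv c) (snd c x)"
      using sc unfolding semiconcave_def semiconcave_on_def by blast
    moreover have "c \<in> charts_at A x" using c by (simp add: charts_at_def)
    ultimately show ?thesis unfolding enlarged_pseudograph_def by blast
  qed
  show "enlarged_pseudograph A K u \<subseteq> cotangent_bundle A" by (rule pseudograph_subset[OF sc])
  fix z assume z: "z \<in> enlarged_pseudograph A K u"
  obtain c where cz: "c \<in> charts_at A (fst z)" using pseudographE[OF sc z] .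
  then have c: "c \<in> A" by (simp add: charts_at_def)
  define L :: "'e \<times> 'e \<Rightarrow> 'e \<times> 'e" where "L = (\<lambda>(y, q). ((2 * K + 1) *\<^sub>R y - q, y))"
  define L' :: "'e \<times> 'e \<Rightarrow> 'e \<times> 'e" where "L' = (\<lambda>(a, b). (b, (2 * K + 1) *\<^sub>R b - a))"
  have L: "bounded_linear L" "bounded_linear L'"
    unfolding L_def L'_def split_beta
    by (intro bounded_linear_intros)+
  have inv: "L' (L w) = w" "L (L' w) = w" for w
    by (auto simp: L_def L'_def split_beta)
  let ?U = "fst (T c)" and ?\<Phi> = "L \<circ> snd (T c)"
  let ?S = "\<lambda>y q. y \<in> snd c ` fst c \<and>
    (\<lambda>h. q \<bullet> h) \<in> superdifferential K (snd c ` fst c) (u \<circ> chart_inv c) y"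
  have chart: "(?U, ?\<Phi>) \<in> smooth_charts (cotangent_atlas A)"
    unfolding smooth_charts_def
  proof (intro CollectI conjI ballI)
    show "fst (?U, ?\<Phi>) \<subseteq> (\<Union>c'\<in>cotangent_atlas A. fst c')"
      using c by (auto simp: cotangent_atlas_def)
    show "inj_on (snd (?U, ?\<Phi>)) (fst (?U, ?\<Phi>))"
      using comp_inj_on[OF cotangent_chart_inj[OF c] inj_on_inverseI[of _ L' L]] inv(1) by simp
    have "open (snd (T c) ` ?U)"
      unfolding cotangent_chart_image[OF c] using chart_open[OF c] by (simp add: open_Times)
    moreover have "L ` W = L' -` W" for W
      using inv by (auto simp: image_iff) metis
    ultimately have "open (L ` (snd (T c) ` ?U))"
      using L(2) by (simp add: open_vimage linear_continuous_on)
    then show "open (snd (?U, ?\<Phi>) ` fst (?U, ?\<Phi>))" by (simp add: image_comp)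
    fix C assume "C \<in> cotangent_atlas A"
    then obtain c' where c': "c' \<in> A" "C = T c'" by (auto simp: cotangent_atlas_def)
    show "smooth_compatible (?U, ?\<Phi>) C"
      unfolding c'(2)
      by (rule smooth_compatible_linear[OF cotangent_charts_compatible[OF c c'(1)] cotangent_chart_inj[OF c] L inv])
  qed
  \<comment> \<open>The first components form the open domain \<open>V\<close>; \<open>l\<close> recovers the base point from them.\<close>
  define V where "V = {(2 * K + 1) *\<^sub>R y - q | y q. ?S y q}"
  have "open V"
    unfolding V_def using sc c by (intro minty_open chart_open) (simp_all add: semiconcave_def)
  have mono: "norm (y - y') \<le> norm (((2 * K + 1) *\<^sub>R y - q) - ((2 * K + 1) *\<^sub>R y' - q'))"
    if "?S y q" "?S y' q'" for y q y' q'
    using that minty_lipschitz[of y "snd c ` fst c" q K "u \<circ> chart_inv c" y' q'] by blast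
  have ex: "\<exists>y q. ?S y q \<and> a = (2 * K + 1) *\<^sub>R y - q" if "a \<in> V" for a
    using that unfolding V_def by blast
  obtain l r where lr: "\<And>a. a \<in> V \<Longrightarrow> ?S (l a) (r a) \<and> a = (2 * K + 1) *\<^sub>R l a - r a"
    using ex by metis
  have lip: "1-lipschitz_on V l"
  proof (rule lipschitz_onI)
    fix a b assume "a \<in> V" "b \<in> V"
    then show "dist (l a) (l b) \<le> 1 * dist a b"
      using mono[of "l a" "r a" "l b" "r b"] lr by (simp add: dist_norm)
  qed simp
  have l: "l ((2 * K + 1) *\<^sub>R y - q) = y" if "?S y q" for y q
  proof -
    let ?a = "(2 * K + 1) *\<^sub>R y - q"
    have "?a \<in> V" unfolding V_def using that by blast
    then have "norm (l ?a - y) \<le> norm (((2 * K + 1) *\<^sub>R l ?a - r ?a) - ?a)" "?a = (2 * K + 1) *\<^sub>R l ?a - r ?a"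
      using mono[of "l ?a" "r ?a" y q] lr that by blast+
    then show ?thesis by (metis diff_self norm_le_zero_iff norm_zero right_minus_eq)
  qed
  have "?\<Phi> ` (enlarged_pseudograph A K u \<inter> ?U) = L ` {(y, q). ?S y q}"
    unfolding pseudograph_image[OF sc c, symmetric] by (simp add: image_comp)
  also have "\<dots> = (\<lambda>a. (a, l a)) ` V"
  proof
    show "L ` {(y, q). ?S y q} \<subseteq> (\<lambda>a. (a, l a)) ` V"
    proof
      fix w assume "w \<in> L ` {(y, q). ?S y q}"
      then obtain y q where S: "?S y q" and w: "w = ((2 * K + 1) *\<^sub>R y - q, y)"
        by (auto simp: L_def)
      have "(2 * K + 1) *\<^sub>R y - q \<in> V" unfolding V_def using S by blast
      then show "w \<in> (\<lambda>a. (a, l a)) ` V" unfolding w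
        by (rule image_eqI[rotated]) (simp only: l[OF S])
    qed
    show "(\<lambda>a. (a, l a)) ` V \<subseteq> L ` {(y, q). ?S y q}"
    proof
      fix w assume "w \<in> (\<lambda>a. (a, l a)) ` V"
      then obtain a where a: "a \<in> V" "w = (a, l a)" by blast
      then have "w = L (l a, r a)" using lr by (simp add: L_def)
      then show "w \<in> L ` {(y, q). ?S y q}" using lr[OF a(1)] by blast
    qed
  qed
  finally have "?\<Phi> ` (enlarged_pseudograph A K u \<inter> ?U) = (\<lambda>a. (a, l a)) ` V" .
  moreover have "z \<in> ?U"
  proof -
    obtain x p where zx: "z = (x, p)" by (rule prod.exhaust)
    have cx: "c \<in> charts_at A x" using cz zx by simp
    obtain q where "p = covector_of c x q"
      using pseudograph_in_chart[OF sc cx] z zx by blast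
    then show ?thesis using covector_of_in_domain[OF c charts_atD(2)[OF cx]] zx by blast
  qed
  ultimately show "\<exists>(U, \<Phi>)\<in>smooth_charts (cotangent_atlas A). z \<in> U \<and>
        (\<exists>(V :: 'e set) (l :: 'e \<Rightarrow> 'e) L. open V \<and> L-lipschitz_on V l \<and>
           \<Phi> ` (enlarged_pseudograph A K u \<inter> U) = (\<lambda>y. (y, l y)) ` V)"
    using chart \<open>open V\<close> lip by blast
qed

end


section \<open>The Liouville form along arcs in the pseudograph\<close>

text \<open>The charts allowed in the definition of a Lipschitz arc are arbitrary; canonical coordinates are
needed to express the Liouville form.\<close>

lemma curve_in_other_chart:
  assumes comp: "smooth_compatible c c'" and inj: "inj_on (snd c) (fst c)"
    and I: "\<gamma> ` I \<subseteq> fst c" "s \<in> I" "\<gamma> s \<in> fst c'" "C-lipschitz_on I (snd c \<circ> \<gamma>)"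
  obtains \<delta> M where "\<delta> > 0" "\<gamma> ` (I \<inter> ball s \<delta>) \<subseteq> fst c'" "M-lipschitz_on (I \<inter> ball s \<delta>) (snd c' \<circ> \<gamma>)"
proof -
  let ?S = "snd c ` (fst c \<inter> fst c')"
  have S: "open ?S" "smooth_on ?S (transition c c')" using comp by (auto simp: smooth_compatible_def)
  have s: "snd c (\<gamma> s) \<in> ?S" using I by blast
  obtain r M where r: "r > 0" "cball (snd c (\<gamma> s)) r \<subseteq> ?S" "M-lipschitz_on (cball (snd c (\<gamma> s)) r) (transition c c')"
    using smooth_on_locally_lipschitz[OF S s] .
  have C: "0 \<le> C" using I(4) lipschitz_on_nonneg by blast
  define \<delta> where "\<delta> = r / (C + 1)"
  have \<delta>: "\<delta> > 0" "C * \<delta> \<le> r" using r(1) C by (auto simp: \<delta>_def field_simps)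
  have eq: "snd c' (\<gamma> r) = transition c c' (snd c (\<gamma> r))" if "r \<in> I" for r
    using transition_apply[OF inj, of "\<gamma> r" c'] I(1) that by auto
  have cb: "snd c (\<gamma> t) \<in> cball (snd c (\<gamma> s)) r" if t: "t \<in> I \<inter> ball s \<delta>" for t
  proof -
    have "dist (snd c (\<gamma> s)) (snd c (\<gamma> t)) \<le> C * dist s t"
      using lipschitz_onD[OF I(4,2), of t] t by simp
    also have "\<dots> \<le> C * \<delta>" using t C by (intro mult_left_mono) auto
    finally show ?thesis using \<delta>(2) by simp
  qed
  have sub: "\<gamma> ` (I \<inter> ball s \<delta>) \<subseteq> fst c'"
  proof (rule image_subsetI)
    fix t assume t: "t \<in> I \<inter> ball s \<delta>"
    then obtain x where x: "x \<in> fst c" "x \<in> fst c'" "snd c (\<gamma> t) = snd c x" using cb[OF t] r(2) by blast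
    then have "\<gamma> t = x" using inj_onD[OF inj x(3)] I(1) t by blast
    then show "\<gamma> t \<in> fst c'" using x by simp
  qed
  have "(M * C)-lipschitz_on (I \<inter> ball s \<delta>) (\<lambda>t. transition c c' ((snd c \<circ> \<gamma>) t))"
    by (rule lipschitz_on_compose2[OF lipschitz_on_subset[OF I(4)] lipschitz_on_subset[OF r(3)]])
      (use cb in auto)
  then have "(M * C)-lipschitz_on (I \<inter> ball s \<delta>) (snd c' \<circ> \<gamma>)"
    by (rule lipschitz_on_transform) (use eq in auto)
  with \<delta>(1) sub that show thesis by blast
qed

context smooth_atlas
begin

lemma arc_locally_lipschitz:
  assumes arc: "lipschitz_arc (cotangent_atlas A) a b \<gamma>" and t: "t \<in> {a..b}"
    and c: "c \<in> A" "\<gamma> t \<in> fst (T c)"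
  obtains \<delta> M where "\<delta> > 0" "\<gamma> ` ({a..b} \<inter> ball t \<delta>) \<subseteq> fst (T c)"
    "M-lipschitz_on ({a..b} \<inter> ball t \<delta>) (snd (T c) \<circ> \<gamma>)"
proof -
  obtain c0 \<delta>0 L where c0: "c0 \<in> smooth_charts (cotangent_atlas A)" "\<delta>0 > 0"
    "\<gamma> ` ({a..b} \<inter> ball t \<delta>0) \<subseteq> fst c0" "L-lipschitz_on ({a..b} \<inter> ball t \<delta>0) (snd c0 \<circ> \<gamma>)"
    using arc t unfolding lipschitz_arc_def by blast
  have "smooth_compatible c0 (T c)" "inj_on (snd c0) (fst c0)"
    using c0(1) c(1) by (auto simp: smooth_charts_def cotangent_atlas_def)
  moreover have "t \<in> {a..b} \<inter> ball t \<delta>0" using t c0(2) by simp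
  ultimately obtain \<delta> M where d: "\<delta> > 0" "\<gamma> ` ({a..b} \<inter> ball t \<delta>0 \<inter> ball t \<delta>) \<subseteq> fst (T c)"
    "M-lipschitz_on ({a..b} \<inter> ball t \<delta>0 \<inter> ball t \<delta>) (snd (T c) \<circ> \<gamma>)"
    using curve_in_other_chart[OF _ _ c0(3) _ c(2) c0(4)] by metis
  have "{a..b} \<inter> ball t \<delta>0 \<inter> ball t \<delta> = {a..b} \<inter> ball t (min \<delta>0 \<delta>)" by auto
  then show thesis using that[of "min \<delta>0 \<delta>" M] d c0(2) by simp
qed

text \<open>The formula \<open>\<lambda> = \<Sum> q\<^sub>i dx\<^sub>i\<close>, for the chart in which \<open>differential\<close> happens to be evaluated. As this
chart depends on the point of the bundle, \<open>arc_derivative\<close> has to cope with all charts.\<close>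

lemma liouville_form_in_chart:
  assumes z: "z \<in> cotangent_bundle A"
  obtains c where "c \<in> A" "z \<in> fst (T c)" "\<And>\<xi>. liouville_form A z \<xi> = snd (snd (T c) z) \<bullet> fst (\<xi> (T c))"
proof -
  define C where "C = (SOME C. C \<in> charts_at (cotangent_atlas A) z)"
  obtain c0 where "c0 \<in> A" "fst z \<in> fst c0" using z by (auto simp: cotangent_bundle_def)
  then have "T c0 \<in> charts_at (cotangent_atlas A) z"
    using z by (simp add: charts_at_def cotangent_atlas_def cotangent_chart_def)
  then have "C \<in> charts_at (cotangent_atlas A) z" unfolding C_def by (rule someI)
  then obtain c where c: "c \<in> A" "C = T c" "z \<in> fst (T c)"
    by (auto simp: charts_at_def cotangent_atlas_def)
  obtain x q where x: "x \<in> fst c" "z = (x, covector_of c x q)"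
    using cotangent_chart_domainE[OF c(1,3)] .
  have cx: "c \<in> charts_at A x" using c x by (simp add: charts_at_def)
  have Tz: "snd (T c) z = (snd c x, q)" using x cotangent_chart_apply[OF cx] by simp
  have D: "frechet_derivative (snd c' \<circ> fst \<circ> chart_inv (T c)) (at (snd (T c) z)) = (\<lambda>h. D c c' x (fst h))"
    if c': "c' \<in> charts_at A x" for c'
  proof -
    have "((\<lambda>w. transition c c' (fst w)) has_derivative (\<lambda>h. D c c' x (fst h))) (at (snd c x, q))"
      by (rule has_derivative_compose[OF bounded_linear_imp_has_derivative[OF bounded_linear_fst]])
        (use D_has_derivative[OF cx c'] in simp)
    then have "((snd c' \<circ> fst \<circ> chart_inv (T c)) has_derivative (\<lambda>h. D c c' x (fst h))) (at (snd c x, q))"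
    proof (rule has_derivative_transform_within_open)
      show "open (snd (T c) ` fst (T c))"
        unfolding cotangent_chart_image[OF c(1)] using chart_open[OF c(1)] by (simp add: open_Times)
      show "(snd c x, q) \<in> snd (T c) ` fst (T c)" using c(3) Tz by (metis imageI)
      fix w assume "w \<in> snd (T c) ` fst (T c)"
      then obtain z' where z': "z' \<in> fst (T c)" "w = snd (T c) z'" by blast
      obtain x' q' where x': "x' \<in> fst c" "z' = (x', covector_of c x' q')"
        using cotangent_chart_domainE[OF c(1) z'(1)] .
      have "chart_inv (T c) w = z'"
        using chart_inv_left[OF cotangent_chart_inj[OF c(1)] z'(1)] z'(2) by simp
      moreover have "fst w = snd c x'"
        using z'(2) x' cotangent_chart_apply'[OF c(1) x'(1)] by simp
      ultimately show "transition c c' (fst w) = (snd c' \<circ> fst \<circ> chart_inv (T c)) w"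
        using x' by (simp add: transition_apply[OF chart_inj[OF c(1)]])
    qed
    then show ?thesis unfolding Tz using frechet_derivative_at by metis
  qed
  have "liouville_form A z \<xi> = snd (snd (T c) z) \<bullet> fst (\<xi> (T c))" for \<xi>
  proof -
    have "differential (cotangent_atlas A) A fst z \<xi> = tangent_of c x (fst (\<xi> (T c)))"
    proof
      fix c'
      have "fst z = x" using x(2) by simp
      then show "differential (cotangent_atlas A) A fst z \<xi> c' = tangent_of c x (fst (\<xi> (T c))) c'"
        unfolding differential_def C_def[symmetric] Let_def c(2) tangent_of_def using D[of c'] by simp
    qed
    then show ?thesis
      unfolding liouville_form_def Tz using x(2) cx
      by (simp add: covector_of_apply tangent_of_in tangent_of_same)
  qed
  with c that show thesis by blast
qed

lemma cotangent_chart_base: "z \<in> fst (T c) \<Longrightarrow> fst z \<in> fst c"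
  by (simp add: cotangent_chart_def)

text \<open>On the pseudograph the Liouville form is the differential of \<open>u\<close>, at the times at which the arc is
differentiable in one, and hence in every, canonical chart.\<close>

lemma arc_derivative:
  assumes sc: "semiconcave A K u" and arc: "lipschitz_arc (cotangent_atlas A) a b \<gamma>"
    and E: "\<gamma> ` {a..b} \<subseteq> enlarged_pseudograph A K u"
    and t: "t \<in> {a<..<b}" and c: "c \<in> A" "\<gamma> t \<in> fst (T c)" and diff: "(snd (T c) \<circ> \<gamma>) differentiable (at t)"
  shows "((\<lambda>s. u (fst (\<gamma> s))) has_real_derivative
    liouville_form A (\<gamma> t) (velocity (cotangent_atlas A) a b \<gamma> t)) (at t)"
proof -
  have tab: "t \<in> {a..b}" using t by simp
  have "\<gamma> t \<in> cotangent_bundle A" using pseudograph_subset[OF sc] E tab by blast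
  then obtain c1 where c1: "c1 \<in> A" "\<gamma> t \<in> fst (T c1)"
    and lf: "\<And>\<xi>. liouville_form A (\<gamma> t) \<xi> = snd (snd (T c1) (\<gamma> t)) \<bullet> fst (\<xi> (T c1))"
    using liouville_form_in_chart by blast
  define g where "g = snd (T c1) \<circ> \<gamma>"
  obtain \<delta>1 M1 where d1: "\<delta>1 > 0" "\<gamma> ` ({a..b} \<inter> ball t \<delta>1) \<subseteq> fst (T c)"
    "M1-lipschitz_on ({a..b} \<inter> ball t \<delta>1) (snd (T c) \<circ> \<gamma>)"
    using arc_locally_lipschitz[OF arc tab c] .
  obtain \<delta> M where d: "\<delta> > 0" "\<gamma> ` ({a..b} \<inter> ball t \<delta>) \<subseteq> fst (T c1)"
    "M-lipschitz_on ({a..b} \<inter> ball t \<delta>) g"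
    unfolding g_def using arc_locally_lipschitz[OF arc tab c1] .
  \<comment> \<open>The arc is assumed to be differentiable in the chart \<open>c\<close>, but the Liouville form is expressed in
    the chart \<open>c1\<close>.\<close>
  have "g differentiable (at t)"
  proof -
    let ?\<tau> = "transition (T c) (T c1)"
    have "(?\<tau> has_derivative frechet_derivative ?\<tau> (at (snd (T c) (\<gamma> t)))) (at (snd (T c) (\<gamma> t)))"
      by (rule transition_has_derivative[OF cotangent_charts_compatible[OF c(1) c1(1)] c(2) c1(2)])
    then have "(?\<tau> \<circ> (snd (T c) \<circ> \<gamma>)) differentiable (at t)"
      using differentiable_chain_at[OF diff, of ?\<tau>] by (auto simp: differentiable_def)
    then obtain g' where "((?\<tau> \<circ> (snd (T c) \<circ> \<gamma>)) has_derivative g') (at t)"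
      by (auto simp: differentiable_def)
    then have "(g has_derivative g') (at t)"
    proof (rule has_derivative_transform_within_open)
      show "open ({a<..<b} \<inter> ball t \<delta>1)" by auto
      show "t \<in> {a<..<b} \<inter> ball t \<delta>1" using t d1(1) by simp
      fix s assume "s \<in> {a<..<b} \<inter> ball t \<delta>1"
      then have "\<gamma> s \<in> fst (T c)" using d1(2) by auto
      then show "(?\<tau> \<circ> (snd (T c) \<circ> \<gamma>)) s = g s"
        unfolding g_def by (simp add: transition_apply cotangent_chart_inj[OF c(1)])
    qed
    then show ?thesis by (auto simp: differentiable_def)
  qed
  then obtain v where v: "(g has_vector_derivative v) (at t)"
    using vector_derivative_works by blast
  let ?J = "{a<..<b} \<inter> ball t \<delta>"
  have JE: "\<gamma> s \<in> enlarged_pseudograph A K u" "\<gamma> s \<in> fst (T c1)" if "s \<in> ?J" for s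
    using that E d(2) by auto
  let ?w = "u \<circ> chart_inv c1"
  have "M-lipschitz_on ?J g" by (rule lipschitz_on_subset[OF d(3)]) auto
  then have lip: "M-lipschitz_on ?J (\<lambda>s. fst (g s))" "M-lipschitz_on ?J (\<lambda>s. snd (g s))"
    unfolding lipschitz_on_def using dist_fst_le dist_snd_le order_trans by blast+
  have y: "((\<lambda>s. fst (g s)) has_vector_derivative fst v) (at t)"
    by (rule bounded_linear.has_vector_derivative[OF bounded_linear_fst v])
  have "((\<lambda>s. ?w (fst (g s))) has_real_derivative snd (g t) \<bullet> fst v) (at t)"
  proof (rule superdifferential_curve_derivative[where J="?J" and K=K and w="?w", OF _ _ _ _ lip y])
    show "0 \<le> K" using sc by (simp add: semiconcave_def)
    show "open ?J" by auto
    show "t \<in> ?J" using t d(1) by simp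
    show "fst (g s) \<in> snd c1 ` fst c1 \<and>
        (\<lambda>h. snd (g s) \<bullet> h) \<in> superdifferential K (snd c1 ` fst c1) ?w (fst (g s))" if "s \<in> ?J" for s
      using pseudograph_coords(2,4)[OF sc c1(1) JE[OF that]] unfolding g_def comp_apply by blast
  qed
  moreover have "?w (fst (g s)) = u (fst (\<gamma> s))" if "s \<in> ?J" for s
  proof -
    have "fst (\<gamma> s) \<in> fst c1" using cotangent_chart_base[OF JE(2)[OF that]] .
    then show ?thesis
      using pseudograph_coords(1)[OF sc c1(1) JE[OF that]]
      by (simp add: g_def chart_inv_left[OF chart_inj[OF c1(1)]])
  qed
  ultimately have "((\<lambda>s. u (fst (\<gamma> s))) has_real_derivative snd (g t) \<bullet> fst v) (at t)"
    using t d(1) by (elim has_field_derivative_transform_within_open[where S="?J"]) auto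
  moreover have "velocity (cotangent_atlas A) a b \<gamma> t (T c1) = v"
  proof -
    have "T c1 \<in> charts_at (cotangent_atlas A) (\<gamma> t)"
      using c1 by (simp add: charts_at_def cotangent_atlas_def)
    then show ?thesis
      using vector_derivative_at[OF v] t by (simp add: velocity_def g_def at_within_Icc_at)
  qed
  ultimately show ?thesis unfolding lf g_def by simp
qed

text \<open>In one chart this is the fundamental theorem of calculus for the Lipschitz function \<open>u \<circ> \<pi> \<circ> \<gamma>\<close>.
The additivity of integrals over adjacent intervals and the compactness of \<open>{a..b}\<close>, in the form of
bisection, extend it to the whole arc.\<close>

lemma arc_integral:
  assumes sc: "semiconcave A K u" and arc: "lipschitz_arc (cotangent_atlas A) a b \<gamma>"
    and E: "\<gamma> ` {a..b} \<subseteq> enlarged_pseudograph A K u"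
  shows "has_arc_integral (cotangent_atlas A) (liouville_form A) a b \<gamma> (u (fst (\<gamma> b)) - u (fst (\<gamma> a)))"
proof -
  define f where "f t = liouville_form A (\<gamma> t) (velocity (cotangent_atlas A) a b \<gamma> t)" for t
  define h where "h t = u (fst (\<gamma> t))" for t
  have ab: "a \<le> b" using arc by (simp add: lipschitz_arc_def)
  define P where "P s r \<longleftrightarrow> a \<le> s \<and> s \<le> r \<and> r \<le> b \<longrightarrow> (f has_integral (h r - h s)) {s..r}" for s r
  have "P a b"
    using ab
  proof (induction rule: Bolzano)
    case (trans s r t)
    then show ?case
      unfolding P_def using has_integral_combine[of s r t f "h r - h s" "h t - h r"] by auto
  next
    case (local t)
    then have t: "t \<in> {a..b}" by simp
    have "\<gamma> t \<in> cotangent_bundle A" using pseudograph_subset[OF sc] E t by blast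
    then obtain c where c: "c \<in> A" "\<gamma> t \<in> fst (T c)"
      using liouville_form_in_chart by metis
    obtain \<delta> M where d: "\<delta> > 0" "\<gamma> ` ({a..b} \<inter> ball t \<delta>) \<subseteq> fst (T c)"
      "M-lipschitz_on ({a..b} \<inter> ball t \<delta>) (snd (T c) \<circ> \<gamma>)"
      using arc_locally_lipschitz[OF arc t c] .
    have "P s r" if sr: "s \<le> t" "t \<le> r" "r - s < \<delta>" for s r
      unfolding P_def
    proof (intro impI)
      assume le: "a \<le> s \<and> s \<le> r \<and> r \<le> b"
      have sub: "{s..r} \<subseteq> {a..b} \<inter> ball t \<delta>" using le sr by (auto simp: dist_real_def)
      define g where "g = snd (T c) \<circ> \<gamma>"
      have lipg: "M-lipschitz_on {s..r} g" unfolding g_def by (rule lipschitz_on_subset[OF d(3) sub])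
      have in_E: "\<gamma> \<tau> \<in> enlarged_pseudograph A K u" "\<gamma> \<tau> \<in> fst (T c)" if "\<tau> \<in> {s..r}" for \<tau>
        using that sub E d(2) by blast+
      have lip: "M-lipschitz_on {s..r} (\<lambda>s. fst (g s))" "M-lipschitz_on {s..r} (\<lambda>s. snd (g s))"
        using lipg unfolding lipschitz_on_def using dist_fst_le dist_snd_le order_trans by blast+
      have sd: "fst (g \<tau>) \<in> snd c ` fst c \<and>
          (\<lambda>h. snd (g \<tau>) \<bullet> h) \<in> superdifferential K (snd c ` fst c) (u \<circ> chart_inv c) (fst (g \<tau>))"
        if "\<tau> \<in> {s..r}" for \<tau>
        using pseudograph_coords(2,4)[OF sc c(1) in_E[OF that]] unfolding g_def comp_apply by blast
      have "0 \<le> K" using sc by (simp add: semiconcave_def)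
      then obtain L where "L-lipschitz_on {s..r} (\<lambda>\<tau>. (u \<circ> chart_inv c) (fst (g \<tau>)))"
        using superdifferential_curve_lipschitz[OF _ bounded_closed_interval sd lip] by blast
      moreover have "(u \<circ> chart_inv c) (fst (g \<tau>)) = h \<tau>" if "\<tau> \<in> {s..r}" for \<tau>
      proof -
        have "fst (\<gamma> \<tau>) \<in> fst c" using cotangent_chart_base[OF in_E(2)[OF that]] .
        then show ?thesis
          using pseudograph_coords(1)[OF sc c(1) in_E[OF that]]
          by (simp add: g_def h_def chart_inv_left[OF chart_inj[OF c(1)]])
      qed
      ultimately have liph: "L-lipschitz_on {s..r} h"
        by (elim lipschitz_on_transform) auto
      obtain N where N: "negligible N" "\<And>\<tau>. \<tau> \<in> {s<..<r} - N \<Longrightarrow> g differentiable (at \<tau>)"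
        using lipschitz_differentiable_ae[OF lipg] by blast
      show "(f has_integral (h r - h s)) {s..r}"
      proof (rule lipschitz_has_integral_derivative[OF liph _ N(1)])
        fix \<tau> assume \<tau>: "\<tau> \<in> {s<..<r} - N"
        then have "\<tau> \<in> {a<..<b}" "\<gamma> \<tau> \<in> fst (T c)" using le in_E(2) by auto
        then show "(h has_real_derivative f \<tau>) (at \<tau>)"
          unfolding h_def f_def
          using arc_derivative[OF sc arc E _ c(1)] N(2)[OF \<tau>] unfolding g_def by blast
      qed (use le in auto)
    qed
    with d(1) show ?case by blast
  qed
  then show ?thesis
    using ab unfolding P_def has_arc_integral_def f_def h_def by simp
qed

end

theorem corollary2:
  fixes X :: "'a topology"
    and A :: "('a, 'e::euclidean_space) chart set"
    and u :: "'a \<Rightarrow> real"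
    and K :: real
  assumes "smooth_manifold X A" and "finite A"
    and "compact_space X" and "connected_space X" and "topspace X \<noteq> {}"
    and "semiconcave A K u"
  shows "exact_lagrangian A (enlarged_pseudograph A K u)"
proof -
  interpret smooth_atlas X A by (rule smooth_atlas.intro) (rule assms(1))
  have "has_arc_integral (cotangent_atlas A) (liouville_form A) a b \<gamma> 0"
    if "lipschitz_arc (cotangent_atlas A) a b \<gamma>" "\<gamma> ` {a..b} \<subseteq> enlarged_pseudograph A K u" "\<gamma> a = \<gamma> b" for a b \<gamma>
    using arc_integral[OF assms(6) that(1,2)] that(3) by simp
  then show ?thesis
    unfolding exact_lagrangian_def using lipschitz_submanifold_pseudograph[OF assms(6,5)] by blast
qed

end
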